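(* Let $p$ be a prime and let $G$ be a nontrivial finite $p$-group of order $p^n$ with $|\gamma_2(G)|=p^k$, $d(G) = d$, $d(G/Z(G)) = \delta$ and $G^{ab} \cong C_{p^{\alpha_1}} \times C_{p^{\alpha_2}} \times \cdots \times C_{p^{\alpha_d}}$, where $\alpha_1 \geq \alpha_2 \geq \cdots \geq \alpha_d\ge 1$. Then \[|M(G)| \leq p^{\frac{1}{2}(d-1)(n-k-(\alpha_1-\alpha_d)) + (\delta-1)k-\max(0, \delta-2)}.\]
   Context: $\gamma_2(G)=[G,G]$ is the commutator subgroup and $Z(G)$ the center of $G$; $G^{ab}=G/\gamma_2(G)$; $C_m$ is the cyclic group of order $m$; $d(H)$ is the minimal number of generators of a group $H$ (equal to $0$ for the trivial group); $M(G)$ is the Schur multiplier of $G$, i.e. $M(G)=H^2(G,\mathbb{C}^{\times})$ with trivial action (for finite $G$, isomorphic to $H_2(G,\mathbb{Z})$). The exponent of $p$ is a rational number, so the inequality is one between real numbers. *)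

theory Defs
  imports Complex_Main "HOL-Algebra.Algebra"
begin

definition group_center :: "('a, 'b) monoid_scheme \<Rightarrow> 'a set" where
  "group_center G = {z \<in> carrier G. \<forall>x\<in>carrier G. z \<otimes>\<^bsub>G\<^esub> x = x \<otimes>\<^bsub>G\<^esub> z}"

text \<open>Meaningful for finitely generated groups only; the trivial group has rank 0, being
  generated by the empty set.\<close>
definition min_generators :: "('a, 'b) monoid_scheme \<Rightarrow> nat" where
  "min_generators G =
     (LEAST m. \<exists>S. S \<subseteq> carrier G \<and> finite S \<and> card S = m \<and> generate G S = carrier G)"

definition nonzero_complex :: "complex monoid" where
  "nonzero_complex = \<lparr>carrier = - {0}, monoid.mult = (*), one = 1\<rparr>"

text \<open>Inhomogeneous cochains of degree 2 of \<open>G\<close> with values in an abelian group \<open>A\<close>, on which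
  \<open>G\<close> acts trivially. The group \<open>A\<close> is written multiplicatively. A cochain is an extensional
  function on \<open>carrier G \<times> carrier G\<close>, so cochains are equal iff they agree there.\<close>

definition cochains2 :: "('a, 'b) monoid_scheme \<Rightarrow> ('c, 'd) monoid_scheme \<Rightarrow> ('a \<times> 'a \<Rightarrow> 'c) monoid" where
  "cochains2 G A = product_group (carrier G \<times> carrier G) (\<lambda>_. A)"

definition cocycles2 :: "('a, 'b) monoid_scheme \<Rightarrow> ('c, 'd) monoid_scheme \<Rightarrow> ('a \<times> 'a \<Rightarrow> 'c) set" where
  "cocycles2 G A = {f \<in> carrier (cochains2 G A).
     \<forall>x\<in>carrier G. \<forall>y\<in>carrier G. \<forall>z\<in>carrier G.
       f (y, z) \<otimes>\<^bsub>A\<^esub> f (x, y \<otimes>\<^bsub>G\<^esub> z) = f (x \<otimes>\<^bsub>G\<^esub> y, z) \<otimes>\<^bsub>A\<^esub> f (x, y)}"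

definition coboundaries2 :: "('a, 'b) monoid_scheme \<Rightarrow> ('c, 'd) monoid_scheme \<Rightarrow> ('a \<times> 'a \<Rightarrow> 'c) set" where
  "coboundaries2 G A =
     (\<lambda>g. \<lambda>(x, y)\<in>carrier G \<times> carrier G. g y \<otimes>\<^bsub>A\<^esub> inv\<^bsub>A\<^esub> (g (x \<otimes>\<^bsub>G\<^esub> y)) \<otimes>\<^bsub>A\<^esub> g x)
       ` (carrier G \<rightarrow> carrier A)"

definition cohomology2 ::
    "('a, 'b) monoid_scheme \<Rightarrow> ('c, 'd) monoid_scheme \<Rightarrow> ('a \<times> 'a \<Rightarrow> 'c) set monoid" where
  "cohomology2 G A = (cochains2 G A)\<lparr>carrier := cocycles2 G A\<rparr> Mod coboundaries2 G A"

definition schur_multiplier :: "('a, 'b) monoid_scheme \<Rightarrow> ('a \<times> 'a \<Rightarrow> complex) set monoid" where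
  "schur_multiplier G = cohomology2 G nonzero_complex"

lemma (in group) group_center_normal: "group_center G \<lhd> G"
proof -
  have inv_c: "inv z \<otimes> x = x \<otimes> inv z"
    if z: "z \<in> carrier G" and c: "\<forall>x\<in>carrier G. z \<otimes> x = x \<otimes> z" and x: "x \<in> carrier G" for z x
  proof -
    have "inv (z \<otimes> inv x) = inv (inv x \<otimes> z)" using c x by simp
    then show ?thesis using z x by (simp add: inv_mult_group)
  qed
  have cl: "z \<in> carrier G" and comm: "x \<in> carrier G \<Longrightarrow> z \<otimes> x = x \<otimes> z"
    if "z \<in> group_center G" for z x
    using that by (auto simp: group_center_def)
  have sub: "subgroup (group_center G) G"
  proof (rule subgroupI)
    show "group_center G \<subseteq> carrier G" by (auto simp: group_center_def)
    have "\<one> \<in> group_center G" by (simp add: group_center_def)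
    then show "group_center G \<noteq> {}" by blast
    fix a assume a: "a \<in> group_center G"
    show "inv a \<in> group_center G"
      using inv_c[OF cl[OF a]] cl[OF a] comm[OF a] unfolding group_center_def by blast
    fix b assume b: "b \<in> group_center G"
    have "a \<otimes> b \<otimes> x = x \<otimes> (a \<otimes> b)" if x: "x \<in> carrier G" for x
      using cl[OF a] cl[OF b] comm[OF a x] comm[OF b x] x by (metis m_assoc)
    then show "a \<otimes> b \<in> group_center G"
      using cl[OF a] cl[OF b] unfolding group_center_def by blast
  qed
  then show ?thesis
  proof (rule normal_invI)
    fix x h assume x: "x \<in> carrier G" and h: "h \<in> group_center G"
    have "x \<otimes> h \<otimes> inv x = h \<otimes> x \<otimes> inv x" by (simp only: comm[OF h x])
    also have "\<dots> = h" using x cl[OF h] by (simp add: m_assoc)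
    finally show "x \<otimes> h \<otimes> inv x \<in> group_center G" using h by simp
  qed
qed

lemma comm_group_nonzero_complex: "comm_group nonzero_complex"
proof (rule comm_groupI)
  show "\<exists>y\<in>carrier nonzero_complex. y \<otimes>\<^bsub>nonzero_complex\<^esub> x = \<one>\<^bsub>nonzero_complex\<^esub>"
    if "x \<in> carrier nonzero_complex" for x
    using that by (intro bexI[of _ "inverse x"]) (auto simp: nonzero_complex_def)
qed (auto simp: nonzero_complex_def)

context
  fixes G :: "('a, 'b) monoid_scheme" and A :: "('c, 'd) monoid_scheme"
  assumes G: "group G" and A: "comm_group A"
begin

interpretation G: group G by (rule G)
interpretation A: comm_group A by (rule A)

lemma comm_group_cochains2: "comm_group (cochains2 G A)"
proof (rule group.group_comm_groupI)
  show "group (cochains2 G A)"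
    by (simp add: cochains2_def A.is_group)
qed (auto simp: cochains2_def PiE_mem intro!: restrict_ext A.m_comm)

interpretation C: comm_group "cochains2 G A" by (rule comm_group_cochains2)

lemma subgroup_cocycles2: "subgroup (cocycles2 G A) (cochains2 G A)"
proof (rule C.subgroupI)
  have cl: "f (x, y) \<in> carrier A"
    if "f \<in> cocycles2 G A" "x \<in> carrier G" "y \<in> carrier G" for f x y
    using that by (auto simp: cocycles2_def cochains2_def)
  have eq: "f (y, z) \<otimes>\<^bsub>A\<^esub> f (x, y \<otimes>\<^bsub>G\<^esub> z) = f (x \<otimes>\<^bsub>G\<^esub> y, z) \<otimes>\<^bsub>A\<^esub> f (x, y)"
    if "f \<in> cocycles2 G A" "x \<in> carrier G" "y \<in> carrier G" "z \<in> carrier G" for f x y z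
    using that by (auto simp: cocycles2_def)
  show "cocycles2 G A \<subseteq> carrier (cochains2 G A)"
    by (auto simp: cocycles2_def)
  have "\<one>\<^bsub>cochains2 G A\<^esub> \<in> cocycles2 G A"
    using C.one_closed by (simp add: cocycles2_def) (simp add: cochains2_def product_group_def)
  then show "cocycles2 G A \<noteq> {}" by blast
  show "inv\<^bsub>cochains2 G A\<^esub> f \<in> cocycles2 G A" if f: "f \<in> cocycles2 G A" for f
  proof -
    have fc: "f \<in> carrier (cochains2 G A)" using f by (simp add: cocycles2_def)
    have "inv\<^bsub>cochains2 G A\<^esub> f = (\<lambda>i\<in>carrier G \<times> carrier G. inv\<^bsub>A\<^esub> f i)"
      using fc by (simp add: cochains2_def A.is_group)
    moreover have "inv\<^bsub>A\<^esub> f (y, z) \<otimes>\<^bsub>A\<^esub> inv\<^bsub>A\<^esub> f (x, y \<otimes>\<^bsub>G\<^esub> z)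
        = inv\<^bsub>A\<^esub> f (x \<otimes>\<^bsub>G\<^esub> y, z) \<otimes>\<^bsub>A\<^esub> inv\<^bsub>A\<^esub> f (x, y)"
      if "x \<in> carrier G" "y \<in> carrier G" "z \<in> carrier G" for x y z
      using arg_cong[OF eq[OF f that], of "m_inv A"] that cl[OF f]
      by (simp add: A.inv_mult)
    ultimately show ?thesis
      using C.inv_closed[OF fc] by (simp add: cocycles2_def)
  qed
  show "f \<otimes>\<^bsub>cochains2 G A\<^esub> g \<in> cocycles2 G A"
    if f: "f \<in> cocycles2 G A" and g: "g \<in> cocycles2 G A" for f g
  proof -
    have "f \<otimes>\<^bsub>cochains2 G A\<^esub> g = (\<lambda>i\<in>carrier G \<times> carrier G. f i \<otimes>\<^bsub>A\<^esub> g i)"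
      by (simp add: cochains2_def)
    moreover have "f (y, z) \<otimes>\<^bsub>A\<^esub> g (y, z) \<otimes>\<^bsub>A\<^esub> (f (x, y \<otimes>\<^bsub>G\<^esub> z) \<otimes>\<^bsub>A\<^esub> g (x, y \<otimes>\<^bsub>G\<^esub> z))
        = f (x \<otimes>\<^bsub>G\<^esub> y, z) \<otimes>\<^bsub>A\<^esub> g (x \<otimes>\<^bsub>G\<^esub> y, z) \<otimes>\<^bsub>A\<^esub> (f (x, y) \<otimes>\<^bsub>A\<^esub> g (x, y))"
      if "x \<in> carrier G" "y \<in> carrier G" "z \<in> carrier G" for x y z
    proof -
      have "f (y, z) \<otimes>\<^bsub>A\<^esub> g (y, z) \<otimes>\<^bsub>A\<^esub> (f (x, y \<otimes>\<^bsub>G\<^esub> z) \<otimes>\<^bsub>A\<^esub> g (x, y \<otimes>\<^bsub>G\<^esub> z))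
          = (f (y, z) \<otimes>\<^bsub>A\<^esub> f (x, y \<otimes>\<^bsub>G\<^esub> z)) \<otimes>\<^bsub>A\<^esub> (g (y, z) \<otimes>\<^bsub>A\<^esub> g (x, y \<otimes>\<^bsub>G\<^esub> z))"
        using that cl[OF f] cl[OF g] by (simp add: A.m_ac)
      also have "\<dots> = (f (x \<otimes>\<^bsub>G\<^esub> y, z) \<otimes>\<^bsub>A\<^esub> f (x, y)) \<otimes>\<^bsub>A\<^esub> (g (x \<otimes>\<^bsub>G\<^esub> y, z) \<otimes>\<^bsub>A\<^esub> g (x, y))"
        by (simp only: eq[OF f that] eq[OF g that])
      also have "\<dots> = f (x \<otimes>\<^bsub>G\<^esub> y, z) \<otimes>\<^bsub>A\<^esub> g (x \<otimes>\<^bsub>G\<^esub> y, z) \<otimes>\<^bsub>A\<^esub> (f (x, y) \<otimes>\<^bsub>A\<^esub> g (x, y))"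
        using that cl[OF f] cl[OF g] by (simp add: A.m_ac)
      finally show ?thesis .
    qed
    moreover have "f \<otimes>\<^bsub>cochains2 G A\<^esub> g \<in> carrier (cochains2 G A)"
      using f g by (auto simp: cocycles2_def)
    ultimately show ?thesis by (simp add: cocycles2_def)
  qed
qed

lemma subgroup_coboundaries2:
  "subgroup (coboundaries2 G A) ((cochains2 G A)\<lparr>carrier := cocycles2 G A\<rparr>)"
proof -
  define D where "D = (\<lambda>g :: 'a \<Rightarrow> 'c. \<lambda>(x, y)\<in>carrier G \<times> carrier G.
    g y \<otimes>\<^bsub>A\<^esub> inv\<^bsub>A\<^esub> (g (x \<otimes>\<^bsub>G\<^esub> y)) \<otimes>\<^bsub>A\<^esub> g x)"
  have B: "coboundaries2 G A = D ` (carrier G \<rightarrow> carrier A)"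
    by (simp add: coboundaries2_def D_def)
  have cl: "g x \<in> carrier A" if "g \<in> carrier G \<rightarrow> carrier A" "x \<in> carrier G" for g x
    using that by auto
  have Dc: "D g \<in> carrier (cochains2 G A)" if "g \<in> carrier G \<rightarrow> carrier A" for g
    using cl[OF that] by (auto simp: cochains2_def D_def)
  have Z: "coboundaries2 G A \<subseteq> cocycles2 G A"
  proof
    fix f assume "f \<in> coboundaries2 G A"
    then obtain g where g: "g \<in> carrier G \<rightarrow> carrier A" and f: "f = D g" by (auto simp: B)
    have "D g (y, z) \<otimes>\<^bsub>A\<^esub> D g (x, y \<otimes>\<^bsub>G\<^esub> z) = D g (x \<otimes>\<^bsub>G\<^esub> y, z) \<otimes>\<^bsub>A\<^esub> D g (x, y)"
      if xyz: "x \<in> carrier G" "y \<in> carrier G" "z \<in> carrier G" for x y z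
    proof -
      have canc: "b \<otimes>\<^bsub>A\<^esub> inv\<^bsub>A\<^esub> u \<otimes>\<^bsub>A\<^esub> a \<otimes>\<^bsub>A\<^esub> (u \<otimes>\<^bsub>A\<^esub> w \<otimes>\<^bsub>A\<^esub> c) = a \<otimes>\<^bsub>A\<^esub> b \<otimes>\<^bsub>A\<^esub> (c \<otimes>\<^bsub>A\<^esub> w)"
        if "a \<in> carrier A" "b \<in> carrier A" "c \<in> carrier A" "u \<in> carrier A" "w \<in> carrier A"
        for a b c u w
      proof -
        have "b \<otimes>\<^bsub>A\<^esub> v \<otimes>\<^bsub>A\<^esub> a \<otimes>\<^bsub>A\<^esub> (u \<otimes>\<^bsub>A\<^esub> w \<otimes>\<^bsub>A\<^esub> c)
            = (v \<otimes>\<^bsub>A\<^esub> u) \<otimes>\<^bsub>A\<^esub> (a \<otimes>\<^bsub>A\<^esub> b \<otimes>\<^bsub>A\<^esub> (c \<otimes>\<^bsub>A\<^esub> w))" if "v \<in> carrier A" for v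
          using that \<open>a \<in> carrier A\<close> \<open>b \<in> carrier A\<close> \<open>c \<in> carrier A\<close> \<open>u \<in> carrier A\<close> \<open>w \<in> carrier A\<close>
          by (simp add: A.m_ac)
        from this[of "inv\<^bsub>A\<^esub> u"]
        show ?thesis using that by simp
      qed
      let ?a = "g x" and ?b = "g y" and ?c = "g z" and ?u = "g (y \<otimes>\<^bsub>G\<^esub> z)"
        and ?v = "g (x \<otimes>\<^bsub>G\<^esub> y)" and ?w = "inv\<^bsub>A\<^esub> (g (x \<otimes>\<^bsub>G\<^esub> y \<otimes>\<^bsub>G\<^esub> z))"
      have m: "?a \<in> carrier A" "?b \<in> carrier A" "?c \<in> carrier A" "?u \<in> carrier A"
        "?v \<in> carrier A" "?w \<in> carrier A"
        using xyz cl[OF g] by auto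
      have "D g (y, z) \<otimes>\<^bsub>A\<^esub> D g (x, y \<otimes>\<^bsub>G\<^esub> z)
          = ?c \<otimes>\<^bsub>A\<^esub> inv\<^bsub>A\<^esub> ?u \<otimes>\<^bsub>A\<^esub> ?b \<otimes>\<^bsub>A\<^esub> (?u \<otimes>\<^bsub>A\<^esub> ?w \<otimes>\<^bsub>A\<^esub> ?a)"
        using xyz by (simp add: D_def G.m_assoc)
      also have "\<dots> = ?b \<otimes>\<^bsub>A\<^esub> ?c \<otimes>\<^bsub>A\<^esub> (?a \<otimes>\<^bsub>A\<^esub> ?w)"
        using m by (intro canc)
      also have "\<dots> = ?a \<otimes>\<^bsub>A\<^esub> ?b \<otimes>\<^bsub>A\<^esub> (?c \<otimes>\<^bsub>A\<^esub> ?w)"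
        using m by (simp add: A.m_ac)
      also have "\<dots> = ?b \<otimes>\<^bsub>A\<^esub> inv\<^bsub>A\<^esub> ?v \<otimes>\<^bsub>A\<^esub> ?a \<otimes>\<^bsub>A\<^esub> (?v \<otimes>\<^bsub>A\<^esub> ?w \<otimes>\<^bsub>A\<^esub> ?c)"
        using m by (intro canc[symmetric])
      also have "\<dots> = D g (x \<otimes>\<^bsub>G\<^esub> y, z) \<otimes>\<^bsub>A\<^esub> D g (x, y)"
      proof -
        have "D g (x \<otimes>\<^bsub>G\<^esub> y, z) = ?c \<otimes>\<^bsub>A\<^esub> ?w \<otimes>\<^bsub>A\<^esub> ?v" "D g (x, y) = ?b \<otimes>\<^bsub>A\<^esub> inv\<^bsub>A\<^esub> ?v \<otimes>\<^bsub>A\<^esub> ?a"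
          using xyz by (simp_all add: D_def)
        moreover have "?v \<otimes>\<^bsub>A\<^esub> ?w \<otimes>\<^bsub>A\<^esub> ?c = ?c \<otimes>\<^bsub>A\<^esub> ?w \<otimes>\<^bsub>A\<^esub> ?v"
          using m by (simp add: A.m_ac)
        moreover have "?b \<otimes>\<^bsub>A\<^esub> inv\<^bsub>A\<^esub> ?v \<otimes>\<^bsub>A\<^esub> ?a \<in> carrier A" "?c \<otimes>\<^bsub>A\<^esub> ?w \<otimes>\<^bsub>A\<^esub> ?v \<in> carrier A"
          using m by auto
        ultimately show ?thesis
          by (metis A.m_comm)
      qed
      finally show ?thesis .
    qed
    then show "f \<in> cocycles2 G A" using Dc[OF g] by (simp add: f cocycles2_def)
  qed
  have "subgroup (coboundaries2 G A) (cochains2 G A)"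
  proof (rule C.subgroupI)
    show "coboundaries2 G A \<subseteq> carrier (cochains2 G A)" using Dc by (auto simp: B)
    show "coboundaries2 G A \<noteq> {}" using A.one_closed by (auto simp: B)
    fix f assume "f \<in> coboundaries2 G A"
    then obtain g where g: "g \<in> carrier G \<rightarrow> carrier A" and f: "f = D g" by (auto simp: B)
    have "inv\<^bsub>cochains2 G A\<^esub> (D g) = (\<lambda>i\<in>carrier G \<times> carrier G. inv\<^bsub>A\<^esub> (D g i))"
      using Dc[OF g] by (simp add: cochains2_def A.is_group)
    also have "\<dots> = D (\<lambda>x. inv\<^bsub>A\<^esub> (g x))"
      using cl[OF g] by (auto simp: D_def fun_eq_iff restrict_def A.inv_mult)
    finally show "inv\<^bsub>cochains2 G A\<^esub> f \<in> coboundaries2 G A"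
      using cl[OF g] by (auto simp: f B)
    fix f' assume "f' \<in> coboundaries2 G A"
    then obtain h where h: "h \<in> carrier G \<rightarrow> carrier A" and f': "f' = D h" by (auto simp: B)
    have "D g \<otimes>\<^bsub>cochains2 G A\<^esub> D h = (\<lambda>i\<in>carrier G \<times> carrier G. D g i \<otimes>\<^bsub>A\<^esub> D h i)"
      by (simp add: cochains2_def)
    also have "\<dots> = D (\<lambda>x. g x \<otimes>\<^bsub>A\<^esub> h x)"
      using cl[OF g] cl[OF h] by (auto simp: D_def fun_eq_iff restrict_def A.inv_mult A.m_ac)
    finally show "f \<otimes>\<^bsub>cochains2 G A\<^esub> f' \<in> coboundaries2 G A"
      using cl[OF g] cl[OF h] by (auto simp: f f' B)
  qed
  then show ?thesis
    using C.subgroup_incl[OF _ subgroup_cocycles2 Z] by simp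
qed

lemma comm_group_cohomology2: "comm_group (cohomology2 G A)"
proof -
  have "comm_group ((cochains2 G A)\<lparr>carrier := cocycles2 G A\<rparr>)"
    using subgroup.subset[OF subgroup_cocycles2]
    by (intro group.group_comm_groupI[OF C.subgroup_imp_group[OF subgroup_cocycles2]])
      (auto intro: C.m_comm)
  then show ?thesis
    unfolding cohomology2_def
    by (rule comm_group.abelian_FactGroup[OF _ subgroup_coboundaries2])
qed

end

lemma comm_group_schur_multiplier: "group G \<Longrightarrow> comm_group (schur_multiplier G)"
  unfolding schur_multiplier_def
  by (rule comm_group_cohomology2[OF _ comm_group_nonzero_complex])

end

theory Submission
  imports Defs
begin

text \<open>A 2-cocycle \<open>f\<close> of \<open>G\<close> and a central element \<open>z\<close> define a linear character
  \<open>x \<mapsto> f (z, x) / f (x, z)\<close> of \<open>G\<close>. If it is trivial, the class of \<open>f\<close> is inflated from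
  \<open>G / \<langle>z\<rangle>\<close>; so the order of \<open>M(G)\<close> is at most the number of these characters times the order of
  the image of inflation from \<open>M(G / \<langle>z\<rangle>)\<close>. If \<open>z\<close> lies in the derived subgroup and has order \<open>p\<close>,
  then the kernel of inflation has at least \<open>p\<close> elements, and the characters factor through \<open>G / Z(G)\<close>,
  so there are at most \<open>p ^ \<delta>\<close> of them. Dividing out such elements one at a time, each step costs a
  factor \<open>p ^ (\<delta> - 1)\<close>. In the last step the derived subgroup is \<open>\<langle>z\<rangle>\<close> with \<open>z = [x, y]\<close>; there
  a character is determined by its values at \<open>x\<close> and \<open>y\<close>, and the step costs only \<open>p\<close>, which yields
  the term \<open>max 0 (\<delta> - 2)\<close>. What remains is the multiplier of the abelianization, which is bounded
  by dividing out its cyclic factors one at a time.\<close>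

section \<open>Complex-valued cocycles\<close>

text \<open>The count mirrors the sequence Hom(<z>, U) -> M(G/<z>) -> M(G) -> Hom(G, U), where U is
  the group of nonzero complex numbers and inflation stands in the middle. Only orders are compared,
  so explicit cocycles suffice. The obstacle to iterating the step is that the rank modulo the
  center must not grow in a quotient. Central elements map to central elements, so the images of a
  set that generates \<open>G\<close> modulo its center generate the quotient modulo its own,
  possibly larger, center. The induction therefore carries such a set and a bound on its size in
  place of \<delta>. The abelianization never changes, because every element divided out lies in the
  derived subgroup. The multiplier of the abelianization costs the sum of the (i - 1) \<alpha> i in
  the exponent. As \<alpha> decreases, the large weights meet the small summands; this yields both
  the factor (d - 1) / 2 and the correction by \<alpha> 1 - \<alpha> d.\<close>

lemma nonzero_complex_simps [simp]:
  "carrier nonzero_complex = - {0}" "x \<otimes>\<^bsub>nonzero_complex\<^esub> y = x * y" "\<one>\<^bsub>nonzero_complex\<^esub> = 1"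
  by (simp_all add: nonzero_complex_def)

lemma group_nonzero_complex [simp]: "group nonzero_complex"
  by (rule comm_group.axioms(2)[OF comm_group_nonzero_complex])

lemma inv_nonzero_complex [simp]: "x \<noteq> 0 \<Longrightarrow> inv\<^bsub>nonzero_complex\<^esub> x = inverse x"
  by (rule group.inv_equality) auto

abbreviation cocycles :: "('a, 'b) monoid_scheme \<Rightarrow> ('a \<times> 'a \<Rightarrow> complex) set" where
  "cocycles G \<equiv> cocycles2 G nonzero_complex"

abbreviation cocycle_group :: "('a, 'b) monoid_scheme \<Rightarrow> ('a \<times> 'a \<Rightarrow> complex) monoid" where
  "cocycle_group G \<equiv> (cochains2 G nonzero_complex)\<lparr>carrier := cocycles G\<rparr>"

lemma cocycles_iff:
  "f \<in> cocycles G \<longleftrightarrow> f \<in> extensional (carrier G \<times> carrier G)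
     \<and> (\<forall>x\<in>carrier G. \<forall>y\<in>carrier G. f (x, y) \<noteq> 0)
     \<and> (\<forall>x\<in>carrier G. \<forall>y\<in>carrier G. \<forall>z\<in>carrier G.
          f (y, z) * f (x, y \<otimes>\<^bsub>G\<^esub> z) = f (x \<otimes>\<^bsub>G\<^esub> y, z) * f (x, y))"
  by (auto simp: cocycles2_def cochains2_def PiE_iff)

text \<open>Stated without inverses and with \<open>g\<close> constrained on the carrier only, so
  that a witness is checked by field arithmetic.\<close>

lemma coboundaries_iff:
  assumes "group G"
  shows "b \<in> coboundaries2 G nonzero_complex \<longleftrightarrow> b \<in> extensional (carrier G \<times> carrier G)
     \<and> (\<exists>g. (\<forall>x\<in>carrier G. g x \<noteq> 0)
          \<and> (\<forall>x\<in>carrier G. \<forall>y\<in>carrier G. b (x, y) * g (x \<otimes>\<^bsub>G\<^esub> y) = g x * g y))"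
    (is "?l \<longleftrightarrow> ?r")
proof -
  interpret group G by fact
  show ?thesis
  proof
    assume ?l
    then obtain g where "g \<in> carrier G \<rightarrow> carrier nonzero_complex" and b: "b = (\<lambda>(x, y)\<in>carrier G \<times> carrier G.
        g y \<otimes>\<^bsub>nonzero_complex\<^esub> inv\<^bsub>nonzero_complex\<^esub> (g (x \<otimes>\<^bsub>G\<^esub> y)) \<otimes>\<^bsub>nonzero_complex\<^esub> g x)"
      unfolding coboundaries2_def by (rule imageE)
    then have g: "\<And>x. x \<in> carrier G \<Longrightarrow> g x \<noteq> 0" by auto
    have "b (x, y) * g (x \<otimes>\<^bsub>G\<^esub> y) = g x * g y" if "x \<in> carrier G" "y \<in> carrier G" for x y
      unfolding b using g that by (simp add: field_simps)
    moreover have "b \<in> extensional (carrier G \<times> carrier G)" unfolding b by simp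
    ultimately show ?r using g by blast
  next
    assume ?r
    then obtain g where ext: "b \<in> extensional (carrier G \<times> carrier G)"
      and g: "\<And>x. x \<in> carrier G \<Longrightarrow> g x \<noteq> 0"
      and b: "\<And>x y. x \<in> carrier G \<Longrightarrow> y \<in> carrier G \<Longrightarrow> b (x, y) * g (x \<otimes>\<^bsub>G\<^esub> y) = g x * g y" by blast
    have "b = (\<lambda>(x, y)\<in>carrier G \<times> carrier G.
        g y \<otimes>\<^bsub>nonzero_complex\<^esub> inv\<^bsub>nonzero_complex\<^esub> (g (x \<otimes>\<^bsub>G\<^esub> y)) \<otimes>\<^bsub>nonzero_complex\<^esub> g x)"
      by (rule extensionalityI[OF ext]) (use g b in \<open>auto simp: field_simps\<close>)
    moreover have "g \<in> carrier G \<rightarrow> carrier nonzero_complex" using g by simp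
    ultimately show ?l unfolding coboundaries2_def by (rule image_eqI)
  qed
qed

lemma comm_group_cocycle_group:
  assumes "group G"
  shows "comm_group (cocycle_group G)"
proof -
  interpret C: comm_group "cochains2 G nonzero_complex"
    by (rule comm_group_cochains2[OF assms comm_group_nonzero_complex])
  note sub = subgroup_cocycles2[OF assms comm_group_nonzero_complex]
  show ?thesis
    using subgroup.subset[OF sub]
    by (intro group.group_comm_groupI[OF C.subgroup_imp_group[OF sub]]) (auto intro: C.m_comm)
qed

lemma mult_cocycle_group [simp]:
  "f \<otimes>\<^bsub>cocycle_group G\<^esub> f' = (\<lambda>i\<in>carrier G \<times> carrier G. f i * f' i)"
  by (simp add: cochains2_def)

lemma one_cocycle_group [simp]: "\<one>\<^bsub>cocycle_group G\<^esub> = (\<lambda>i\<in>carrier G \<times> carrier G. 1)"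
  by (simp add: cochains2_def)

lemma pow_cocycle_group:
  assumes "group G"
  shows "f [^]\<^bsub>cocycle_group G\<^esub> (n::nat) = (\<lambda>i\<in>carrier G \<times> carrier G. f i ^ n)"
proof (induction n)
  case 0
  interpret Z: comm_group "cocycle_group G" by (rule comm_group_cocycle_group) fact
  show ?case unfolding Z.nat_pow_0 by simp
next
  case (Suc n)
  interpret Z: comm_group "cocycle_group G" by (rule comm_group_cocycle_group) fact
  show ?case unfolding Z.nat_pow_Suc Suc mult_cocycle_group by (rule restrict_ext) simp
qed

lemma normal_coboundaries:
  assumes "group G"
  shows "coboundaries2 G nonzero_complex \<lhd> cocycle_group G"
  by (intro comm_group.normal_iff_subgroup[THEN iffD2] comm_group_cocycle_group
      subgroup_coboundaries2 comm_group_nonzero_complex assms)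

definition cocycle_class :: "('a, 'b) monoid_scheme \<Rightarrow> ('a \<times> 'a \<Rightarrow> complex) \<Rightarrow> ('a \<times> 'a \<Rightarrow> complex) set"
  where "cocycle_class G f = coboundaries2 G nonzero_complex #>\<^bsub>cocycle_group G\<^esub> f"

lemma cocycle_class_hom:
  assumes "group G"
  shows "cocycle_class G \<in> hom (cocycle_group G) (schur_multiplier G)"
  using normal.r_coset_hom_Mod[OF normal_coboundaries[OF assms]]
  by (simp add: schur_multiplier_def cohomology2_def cocycle_class_def[abs_def])

lemma carrier_schur_multiplier:
  "carrier (schur_multiplier G) = cocycle_class G ` cocycles G"
  by (auto simp: schur_multiplier_def cohomology2_def cocycle_class_def carrier_FactGroup)

lemma cocycle_class_eq_one_iff:
  assumes "group G" "f \<in> cocycles G"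
  shows "cocycle_class G f = \<one>\<^bsub>schur_multiplier G\<^esub> \<longleftrightarrow> f \<in> coboundaries2 G nonzero_complex"
proof -
  interpret Z: comm_group "cocycle_group G" by (rule comm_group_cocycle_group) fact
  note sub = subgroup_coboundaries2[OF assms(1) comm_group_nonzero_complex]
  have "\<one>\<^bsub>schur_multiplier G\<^esub> = coboundaries2 G nonzero_complex"
    by (simp add: schur_multiplier_def cohomology2_def FactGroup_def)
  moreover have "f \<in> carrier (cocycle_group G)" using assms by simp
  ultimately show ?thesis
    unfolding cocycle_class_def
    by (metis Z.coset_join1 Z.coset_join2 sub subgroup.subset)
qed

text \<open>Commutators die in an abelian target. This serves twice: to exclude a character with a
  nontrivial value at \<open>z\<close>, and to make the pairing of \<open>z\<close> with central
  elements trivial.\<close>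

lemma (in group) nonzero_complex_hom_eq_one_on_derived:
  assumes h: "h \<in> hom G nonzero_complex" and x: "x \<in> derived G (carrier G)"
  shows "h x = 1"
proof -
  interpret C: comm_group nonzero_complex by (rule comm_group_nonzero_complex)
  interpret h: group_hom G nonzero_complex h
    using h by unfold_locales
  have "derived nonzero_complex (h ` carrier G) = {1}"
    using C.derived_eq_singleton[OF hom_carrier[OF h]] by simp
  then have "h ` derived G (carrier G) = {1}"
    using h.derived_img[of "carrier G"] by simp
  with x show ?thesis by blast
qed

section \<open>The commutation pairing of a cocycle\<close>

text \<open>For commuting \<open>x\<close> and \<open>y\<close> this is the commutator of lifts of \<open>x\<close> and \<open>y\<close> to the central
  extension defined by the cocycle.\<close>
definition cpair :: "('a \<times> 'a \<Rightarrow> complex) \<Rightarrow> 'a \<Rightarrow> 'a \<Rightarrow> complex" where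
  "cpair f x y = f (x, y) / f (y, x)"

context group
begin

lemma cocycle_nonzero: "f \<in> cocycles G \<Longrightarrow> x \<in> carrier G \<Longrightarrow> y \<in> carrier G \<Longrightarrow> f (x, y) \<noteq> 0"
  by (simp add: cocycles_iff)

lemma cocycle_eq:
  "f \<in> cocycles G \<Longrightarrow> x \<in> carrier G \<Longrightarrow> y \<in> carrier G \<Longrightarrow> z \<in> carrier G \<Longrightarrow>
     f (y, z) * f (x, y \<otimes> z) = f (x \<otimes> y, z) * f (x, y)"
  by (simp add: cocycles_iff)

text \<open>Conjugation by a lift of \<open>w\<close> rescales the lifts of \<open>x\<close> and
  \<open>y\<close>, and conjugation is multiplicative. In terms of the cocycle, \<open>w\<close> is
  moved past \<open>x \<otimes> y\<close> in two steps, which uses the cocycle identity at the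
  triples (x, y, w), (x, w, y) and (w, x, y).\<close>

lemma cpair_mult:
  assumes f: "f \<in> cocycles G" and c: "x \<in> carrier G" "y \<in> carrier G" "w \<in> carrier G"
    and xw: "x \<otimes> w = w \<otimes> x" and yw: "y \<otimes> w = w \<otimes> y"
  shows "cpair f (x \<otimes> y) w = cpair f x w * cpair f y w"
proof -
  have 1: "f (y, w) * f (x, w \<otimes> y) = f (x \<otimes> y, w) * f (x, y)"
    using cocycle_eq[OF f c(1,2,3)] yw by simp
  have 2: "f (w, y) * f (x, w \<otimes> y) = f (w \<otimes> x, y) * f (x, w)"
    using cocycle_eq[OF f c(1,3,2)] xw by simp
  have 3: "f (x, y) * f (w, x \<otimes> y) = f (w \<otimes> x, y) * f (w, x)"
    using cocycle_eq[OF f c(3,1,2)] .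
  have nz: "f (x \<otimes> y, w) \<noteq> 0" "f (w, x \<otimes> y) \<noteq> 0" "f (x, w) \<noteq> 0" "f (w, x) \<noteq> 0" "f (y, w) \<noteq> 0"
    "f (w, y) \<noteq> 0" "f (x, y) \<noteq> 0" "f (x, w \<otimes> y) \<noteq> 0" "f (w \<otimes> x, y) \<noteq> 0"
    using cocycle_nonzero[OF f] c by simp_all
  have e1: "f (x \<otimes> y, w) = f (y, w) * f (x, w \<otimes> y) / f (x, y)"
    using 1 nz by (simp add: field_simps)
  have e2: "f (w, x \<otimes> y) = f (w, y) * f (x, w \<otimes> y) * f (w, x) / (f (x, w) * f (x, y))"
    using 2 3 nz by (simp add: field_simps)
  show ?thesis
    unfolding cpair_def e1 e2 using nz by (simp add: field_simps)
qed

lemma cpair_nonzero: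
  "f \<in> cocycles G \<Longrightarrow> x \<in> carrier G \<Longrightarrow> y \<in> carrier G \<Longrightarrow> cpair f x y \<noteq> 0"
  by (simp add: cpair_def cocycle_nonzero)

lemma cpair_swap: "cpair f x y = inverse (cpair f y x)"
  by (simp add: cpair_def)

lemma cpair_one:
  assumes f: "f \<in> cocycles G" and w: "w \<in> carrier G"
  shows "cpair f \<one> w = 1"
  using cpair_mult[OF f one_closed one_closed w] cpair_nonzero[OF f one_closed w] w by simp

lemma cpair_self: "f \<in> cocycles G \<Longrightarrow> x \<in> carrier G \<Longrightarrow> cpair f x x = 1"
  by (simp add: cpair_def cocycle_nonzero)

lemma cpair_pow:
  assumes f: "f \<in> cocycles G" and c: "x \<in> carrier G" "w \<in> carrier G" and xw: "x \<otimes> w = w \<otimes> x"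
  shows "cpair f (x [^] (n::nat)) w = cpair f x w ^ n"
proof (induction n)
  case (Suc n)
  have "x [^] n \<otimes> w = w \<otimes> x [^] n"
  proof (induction n)
    case (Suc n)
    then show ?case using c xw by (metis m_assoc nat_pow_Suc nat_pow_closed)
  qed (use c in simp)
  then show ?case using Suc cpair_mult[OF f _ _ _ _ xw] c by simp
qed (simp add: cpair_one[OF f] c)

text \<open>Multiplicativity on the centralizer of \<open>w\<close> lets the values at
  \<open>x\<close> and \<open>y\<close> cancel against those at their inverses, while
  \<open>x\<close> and \<open>y\<close> themselves may fail to commute.\<close>

lemma cpair_commutator:
  assumes f: "f \<in> cocycles G" and c: "x \<in> carrier G" "y \<in> carrier G" "w \<in> carrier G"
    and xw: "x \<otimes> w = w \<otimes> x" and yw: "y \<otimes> w = w \<otimes> y"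
  shows "cpair f (x \<otimes> y \<otimes> inv x \<otimes> inv y) w = 1"
proof -
  have inv_comm: "inv u \<otimes> w = w \<otimes> inv u" if "u \<in> carrier G" "u \<otimes> w = w \<otimes> u" for u
    by (metis c(3) inv_closed inv_solve_left inv_solve_right m_assoc m_closed that)
  have inv_pair: "cpair f (inv u) w * cpair f u w = 1" if "u \<in> carrier G" "u \<otimes> w = w \<otimes> u" for u
    using cpair_mult[OF f _ that(1) c(3) inv_comm[OF that] that(2)] that cpair_one[OF f c(3)] by simp
  have mult_comm: "(u \<otimes> v) \<otimes> w = w \<otimes> (u \<otimes> v)"
    if "u \<in> carrier G" "u \<otimes> w = w \<otimes> u" "v \<in> carrier G" "v \<otimes> w = w \<otimes> v" for u v
    using that c(3) by (metis m_assoc)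
  have "cpair f (x \<otimes> y \<otimes> inv x \<otimes> inv y) w =
      (cpair f (inv x) w * cpair f x w) * (cpair f (inv y) w * cpair f y w)"
    using c xw yw by (simp add: cpair_mult[OF f] mult_comm inv_comm)
  then show ?thesis
    using inv_pair c xw yw by simp
qed

lemma group_centerD:
  "z \<in> group_center G \<Longrightarrow> z \<in> carrier G"
  "z \<in> group_center G \<Longrightarrow> x \<in> carrier G \<Longrightarrow> z \<otimes> x = x \<otimes> z"
  by (auto simp: group_center_def)

lemma cpair_central_hom:
  assumes f: "f \<in> cocycles G" and z: "z \<in> group_center G"
  shows "(\<lambda>x. cpair f x z) \<in> hom G nonzero_complex" "cpair f z \<in> hom G nonzero_complex"
  using cpair_mult[OF f] group_centerD[OF z] cpair_nonzero[OF f]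
  by (auto intro!: homI simp: cpair_swap[of f z])

text \<open>Along a coset of <z> the values of \<open>g\<close> are forced once one of them is
  chosen, since each translation by \<open>z\<close> multiplies by \<open>h\<close>. After
  \<open>ord z\<close> translations the walk is back at its start, and \<open>prod\<close> is
  exactly the condition that the values close up.\<close>

lemma twisted_equivariant_function:
  fixes h :: "'a \<Rightarrow> complex"
  assumes fin: "finite (carrier G)" and z: "z \<in> carrier G"
    and nz: "\<And>x. x \<in> carrier G \<Longrightarrow> h x \<noteq> 0"
    and prod: "\<And>x. x \<in> carrier G \<Longrightarrow> (\<Prod>j\<in>{..< ord z}. h (z [^] j \<otimes> x)) = 1"
  obtains g where "\<And>x. x \<in> carrier G \<Longrightarrow> g x \<noteq> 0"
    "\<And>x. x \<in> carrier G \<Longrightarrow> g (z \<otimes> x) = h x * g x"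
proof -
  define N where "N = generate G {z}"
  have N: "N = {z [^] k | k. k \<in> (UNIV :: nat set)}"
    using generate_pow_on_finite_carrier[OF fin z] by (simp add: N_def)
  have subN: "subgroup N G" unfolding N_def using z by (intro generate_is_subgroup) simp
  have m: "ord z > 0" using ord_ge_1[OF fin z] by simp
  \<comment> \<open>The choice depends on the coset only, so all its elements share one
    representative.\<close>
  define rep where "rep x = (SOME y. y \<in> N #> x)" for x
  have rep: "rep x \<in> N #> x" if "x \<in> carrier G" for x
    unfolding rep_def using rcos_self[OF that subN] by (rule someI)
  have rep_carrier: "rep x \<in> carrier G" if "x \<in> carrier G" for x
    using rep[OF that] r_coset_subset_G subgroup.subset[OF subN] that by blast
  have coset_rep: "N #> rep x = N #> x" if "x \<in> carrier G" for x
    using repr_independence[OF rep[OF that] that subN] by simp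
  have ex: "\<exists>i < ord z. x = z [^] i \<otimes> rep x" if "x \<in> carrier G" for x
  proof -
    have "x \<in> N #> rep x" using coset_rep[OF that] rcos_self[OF that subN] by simp
    then obtain k where "k \<in> {0..ord z - 1}" "x = z [^] k \<otimes> rep x"
      unfolding N ord_elems[OF fin z] r_coset_def by blast
    with m show ?thesis by (intro exI[of _ k]) auto
  qed
  define idx where "idx x = (SOME i. i < ord z \<and> x = z [^] i \<otimes> rep x)" for x
  have idx: "idx x < ord z" "x = z [^] idx x \<otimes> rep x" if "x \<in> carrier G" for x
    using someI_ex[OF ex[OF that]] by (auto simp: idx_def)
  \<comment> \<open>The value at the representative is 1, and \<open>idx x\<close> counts the
    translations from there to \<open>x\<close>.\<close>
  define g where "g x = (\<Prod>j\<in>{..<idx x}. h (z [^] j \<otimes> rep x))" for x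
  show thesis
  proof
    fix x assume x: "x \<in> carrier G"
    show "g x \<noteq> 0" unfolding g_def using nz z rep_carrier[OF x] by simp
    have zx: "z \<otimes> x \<in> carrier G" using z x by simp
    have "z \<in> N" unfolding N_def by (simp add: generate.incl)
    then have "z \<otimes> x \<in> N #> x" by (auto simp: r_coset_def)
    then have same: "rep (z \<otimes> x) = rep x"
      using repr_independence[OF _ x subN] by (simp add: rep_def)
    have "z [^] idx (z \<otimes> x) \<otimes> rep x = z \<otimes> (z [^] idx x \<otimes> rep x)"
      using idx(2)[OF zx] idx(2)[OF x] same by simp
    also have "\<dots> = z [^] Suc (idx x) \<otimes> rep x"
      using z rep_carrier[OF x] nat_pow_Suc2[of z "idx x"] by (simp add: m_assoc del: nat_pow_Suc)
    finally have eq: "z [^] idx (z \<otimes> x) = z [^] Suc (idx x)"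
      using z rep_carrier[OF x] by (simp del: nat_pow_Suc)
    show "g (z \<otimes> x) = h x * g x"
    \<comment> \<open>Either the translation stays within the period, or it wraps around to index 0
      and the full product over the coset appears.\<close>
    proof (cases "Suc (idx x) < ord z")
      case True
      then have "idx (z \<otimes> x) = Suc (idx x)"
        using eq idx(1)[OF zx] ord_inj[OF z] by (auto simp: inj_on_def simp del: nat_pow_Suc)
      then show ?thesis using idx(2)[OF x] by (simp add: g_def same mult.commute)
    next
      case False
      then have s: "Suc (idx x) = ord z" using idx(1)[OF x] by simp
      then have "z [^] idx (z \<otimes> x) = z [^] (0::nat)"
        using eq z by (simp del: nat_pow_Suc)
      then have "idx (z \<otimes> x) = 0"
        using idx(1)[OF zx] ord_inj[OF z] m by (auto simp: inj_on_def simp del: nat_pow_0)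
      moreover have "h x * g x = (\<Prod>j\<in>{..<Suc (idx x)}. h (z [^] j \<otimes> rep x))"
        using idx(2)[OF x] by (simp add: g_def mult.commute)
      ultimately show ?thesis
        using prod[OF rep_carrier[OF x]] s by (simp add: g_def same)
    qed
  qed
qed

end

section \<open>Quotients by a central cyclic subgroup\<close>

lemma (in group_hom) card_image_mult_card_kernel:
  "card (h ` carrier G) * card (kernel G H h) = order G"
proof -
  have el: "the_elem (h ` (kernel G H h #> g)) = h g" if "g \<in> carrier G" for g
  proof -
    have "h y = h g" if "y \<in> kernel G H h #> g" for y
      using that \<open>g \<in> carrier G\<close> by (auto simp: kernel_def r_coset_def)
    moreover have "kernel G H h #> g \<noteq> {}"
      using G.rcos_self[OF that subgroup_kernel] by blast
    ultimately show ?thesis by (intro the_elem_image_unique)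
  qed
  have "(\<lambda>B. the_elem (h ` B)) ` carrier (G Mod kernel G H h) = h ` carrier G"
    by (simp add: carrier_FactGroup image_image el cong: image_cong)
  then have "card (h ` carrier G) = card (carrier (G Mod kernel G H h))"
    using card_image[OF FactGroup_inj_on] by simp
  then show ?thesis
    using G.lagrange[OF subgroup_kernel] by (simp add: FactGroup_def)
qed

text \<open>\<open>H\<close> plays the role of G/<z> but may be any surjective image with kernel
  <z>: it is instantiated by a product with one cyclic factor fewer, by a quotient living on the
  element type of \<open>G\<close>, and by the abelianization \<open>A\<close>.\<close>

locale central_cyclic_quotient = group_hom G H \<pi>
  for G :: "('a, 'b) monoid_scheme" (structure) and H :: "('c, 'd) monoid_scheme" (structure) and \<pi> +
  fixes z
  assumes finite_G: "finite (carrier G)"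
    and surj: "\<pi> ` carrier G = carrier H"
    and central: "z \<in> group_center G"
    and kernel: "kernel G H \<pi> = generate G {z}"
begin

lemma z_closed [simp]: "z \<in> carrier G"
  using G.group_centerD(1)[OF central] .

lemma z_comm: "x \<in> carrier G \<Longrightarrow> z \<otimes> x = x \<otimes> z"
  using G.group_centerD(2)[OF central] .

lemma image_z [simp]: "\<pi> z = \<one>\<^bsub>H\<^esub>"
proof -
  have "z \<in> kernel G H \<pi>" unfolding kernel by (rule generate.incl) simp
  then show ?thesis by (simp add: kernel_def)
qed

lemma fibreE:
  assumes "x \<in> carrier G" "y \<in> carrier G" "\<pi> x = \<pi> y"
  obtains i :: nat where "x = z [^] i \<otimes> y"
proof -
  have "x \<otimes> inv y \<in> kernel G H \<pi>" using assms by (simp add: kernel_def)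
  then obtain i :: nat where "x \<otimes> inv y = z [^] i"
    unfolding kernel using G.generate_pow_on_finite_carrier[OF finite_G z_closed] by auto
  then have "x = z [^] i \<otimes> y"
    using assms by (metis G.inv_closed G.inv_solve_right z_closed G.nat_pow_closed)
  then show thesis by (rule that)
qed

lemma fibrewise_constant:
  assumes inv: "\<And>x. x \<in> carrier G \<Longrightarrow> u (z \<otimes> x) = u x"
    and xy: "x \<in> carrier G" "y \<in> carrier G" "\<pi> x = \<pi> y"
  shows "u x = u y"
proof -
  obtain i :: nat where x: "x = z [^] i \<otimes> y" using fibreE[OF xy] .
  have "u (z [^] i \<otimes> y) = u y"
  proof (induction i)
    case (Suc i)
    have "z [^] Suc i \<otimes> y = z \<otimes> (z [^] i \<otimes> y)"
      using xy(2) G.nat_pow_Suc2[of z i] by (simp add: G.m_assoc del: G.nat_pow_Suc)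
    then show ?case using inv[of "z [^] i \<otimes> y"] Suc xy by simp
  qed (use xy in simp)
  with x show ?thesis by simp
qed

definition lift where "lift a = inv_into (carrier G) \<pi> a"

lemma lift_closed: "a \<in> carrier H \<Longrightarrow> lift a \<in> carrier G"
  using inv_into_into[of a \<pi> "carrier G"] by (simp add: surj lift_def)

lemma image_lift: "a \<in> carrier H \<Longrightarrow> \<pi> (lift a) = a"
  using f_inv_into_f[of a \<pi> "carrier G"] by (simp add: surj lift_def)

section \<open>Descent and inflation of cocycles along the quotient map\<close>

lemma descend_cocycle:
  assumes nz: "\<And>x y. x \<in> carrier G \<Longrightarrow> y \<in> carrier G \<Longrightarrow> f x y \<noteq> (0::complex)"
    and eq: "\<And>x y w. x \<in> carrier G \<Longrightarrow> y \<in> carrier G \<Longrightarrow> w \<in> carrier G \<Longrightarrow>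
      f y w * f x (y \<otimes> w) = f (x \<otimes> y) w * f x y"
    and inv1: "\<And>x y. x \<in> carrier G \<Longrightarrow> y \<in> carrier G \<Longrightarrow> f (z \<otimes> x) y = f x y"
    and inv2: "\<And>x y. x \<in> carrier G \<Longrightarrow> y \<in> carrier G \<Longrightarrow> f x (z \<otimes> y) = f x y"
  obtains f' where "f' \<in> cocycles H"
    "\<And>x y. x \<in> carrier G \<Longrightarrow> y \<in> carrier G \<Longrightarrow> f' (\<pi> x, \<pi> y) = f x y"
proof -
  define f' where "f' = (\<lambda>(a, b)\<in>carrier H \<times> carrier H. f (lift a) (lift b))"
  have f': "f' (\<pi> x, \<pi> y) = f x y" if xy: "x \<in> carrier G" "y \<in> carrier G" for x y
  proof -
    have l: "lift (\<pi> x) \<in> carrier G" "lift (\<pi> y) \<in> carrier G"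
      using xy by (simp_all add: lift_closed)
    have "f (lift (\<pi> x)) (lift (\<pi> y)) = f x (lift (\<pi> y))"
      by (rule fibrewise_constant[of "\<lambda>x. f x (lift (\<pi> y))"]) (use inv1 l xy image_lift in auto)
    also have "\<dots> = f x y"
      by (rule fibrewise_constant[of "f x"]) (use inv2 l xy image_lift in auto)
    finally show ?thesis using xy by (simp add: f'_def)
  qed
  have "f' (b, c) * f' (a, b \<otimes>\<^bsub>H\<^esub> c) = f' (a \<otimes>\<^bsub>H\<^esub> b, c) * f' (a, b) \<and> f' (a, b) \<noteq> 0"
    if abc: "a \<in> carrier H" "b \<in> carrier H" "c \<in> carrier H" for a b c
  proof -
    obtain x y w where x: "x \<in> carrier G" "y \<in> carrier G" "w \<in> carrier G"
      and a: "a = \<pi> x" "b = \<pi> y" "c = \<pi> w"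
      using abc unfolding surj[symmetric] by blast
    show ?thesis
      unfolding a using x eq[OF x] nz by (simp add: f' flip: hom_mult)
  qed
  then have "f' \<in> cocycles H" unfolding cocycles_iff by (auto simp: f'_def)
  from that[OF this f'] show thesis .
qed

definition inflate :: "('c \<times> 'c \<Rightarrow> complex) \<Rightarrow> 'a \<times> 'a \<Rightarrow> complex" where
  "inflate f = (\<lambda>(x, y)\<in>carrier G \<times> carrier G. f (\<pi> x, \<pi> y))"

lemma inflate_closed: "f \<in> cocycles H \<Longrightarrow> inflate f \<in> cocycles G"
  by (auto simp: cocycles_iff inflate_def)

lemma coboundaries_subset: "group K \<Longrightarrow> coboundaries2 K nonzero_complex \<subseteq> cocycles K"
  using subgroup.subset[OF subgroup_coboundaries2[OF _ comm_group_nonzero_complex]] by simp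

lemma inflate_coboundary:
  assumes "f \<in> coboundaries2 H nonzero_complex"
  shows "inflate f \<in> coboundaries2 G nonzero_complex"
proof -
  obtain g where "\<And>x. x \<in> carrier H \<Longrightarrow> g x \<noteq> 0"
    "\<And>x y. x \<in> carrier H \<Longrightarrow> y \<in> carrier H \<Longrightarrow> f (x, y) * g (x \<otimes>\<^bsub>H\<^esub> y) = g x * g y"
    using assms unfolding coboundaries_iff[OF H.is_group] by blast
  then show ?thesis
    unfolding coboundaries_iff[OF G.is_group]
    by (intro conjI exI[of _ "g \<circ> \<pi>"]) (auto simp: inflate_def)
qed

lemma inflation_hom:
  obtains \<iota> where "\<iota> \<in> hom (schur_multiplier H) (schur_multiplier G)"
    "\<And>f. f \<in> cocycles H \<Longrightarrow> \<iota> (cocycle_class H f) = cocycle_class G (inflate f)"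
proof -
  interpret ZG: comm_group "cocycle_group G" by (rule comm_group_cocycle_group) (rule G.is_group)
  interpret ZH: comm_group "cocycle_group H" by (rule comm_group_cocycle_group) (rule H.is_group)
  interpret MG: comm_group "schur_multiplier G" by (rule comm_group_schur_multiplier) (rule G.is_group)
  have infl: "inflate \<in> hom (cocycle_group H) (cocycle_group G)"
  proof (rule homI)
    show "inflate (x \<otimes>\<^bsub>cocycle_group H\<^esub> y) = inflate x \<otimes>\<^bsub>cocycle_group G\<^esub> inflate y" for x y
      unfolding mult_cocycle_group by (auto simp: inflate_def fun_eq_iff)
  qed (simp add: inflate_closed)
  interpret group_hom "cocycle_group H" "schur_multiplier G" "cocycle_class G \<circ> inflate"
    using Group.hom_compose[OF infl cocycle_class_hom[OF G.is_group]] by unfold_locales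
  have "coboundaries2 H nonzero_complex
      \<subseteq> Coset.kernel (cocycle_group H) (schur_multiplier G) (cocycle_class G \<circ> inflate)"
    using inflate_coboundary inflate_closed cocycle_class_eq_one_iff[OF G.is_group]
      coboundaries_subset[OF H.is_group]
    by (auto simp: kernel_def)
  then obtain g where "g \<in> hom (cocycle_group H Mod coboundaries2 H nonzero_complex) (schur_multiplier G)"
    "\<And>f. f \<in> carrier (cocycle_group H) \<Longrightarrow>
      g (coboundaries2 H nonzero_complex #>\<^bsub>cocycle_group H\<^esub> f) = (cocycle_class G \<circ> inflate) f"
    using FactGroup_universal_kernel[OF normal_coboundaries[OF H.is_group]] by blast
  then show thesis
    by (intro that[of g]) (simp_all add: schur_multiplier_def cohomology2_def cocycle_class_def)
qed

text \<open>Let F(x, y) = f(x, y) g(x) g(y) / g(x y). Invariance of F under \<open>z\<close> in the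
  first argument follows from g(z x) = c f(z, x) g(x) with a constant \<open>c\<close>, and
  \<open>sym\<close> then gives invariance in the second. Such a \<open>g\<close> exists if the
  product of the c f(z, z^j x) over a period is 1 for every \<open>x\<close>. A root of a complex
  number provides \<open>c\<close>; this is where divisibility of the coefficient group
  enters.\<close>

lemma class_eq_inflated:
  assumes f: "f \<in> cocycles G" and sym: "\<And>x. x \<in> carrier G \<Longrightarrow> f (z, x) = f (x, z)"
  obtains f' where "f' \<in> cocycles H" "cocycle_class G f = cocycle_class G (inflate f')"
proof -
  note eq = G.cocycle_eq[OF f] and nz = G.cocycle_nonzero[OF f]
  define P where "P = (\<Prod>j\<in>{..< G.ord z}. f (z, z [^] j))"
  have m: "G.ord z > 0" using G.ord_ge_1[OF finite_G z_closed] by simp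
  \<comment> \<open>Multiply the cocycle identities at (z, z^j, x) over a period. The factors f(z^j,
    x) and f(z^(j+1), x) run through the same values, hence cancel.\<close>
  have P_const: "(\<Prod>j\<in>{..< G.ord z}. f (z, z [^] j \<otimes> x)) = P" if x: "x \<in> carrier G" for x
  proof -
    define Q where "Q = (\<Prod>j\<in>{..< G.ord z}. f (z [^] j, x))"
    have "Q = f (\<one>, x) * (\<Prod>j\<in>{..< G.ord z - 1}. f (z [^] Suc j, x))"
      unfolding Q_def using prod.lessThan_Suc_shift[of "\<lambda>j. f (z [^] j, x)" "G.ord z - 1"] m
      by (simp del: G.nat_pow_Suc)
    also have "\<dots> = (\<Prod>j\<in>{..< G.ord z}. f (z [^] Suc j, x))"
      using prod.lessThan_Suc[of "\<lambda>j. f (z [^] Suc j, x)" "G.ord z - 1"] m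
      by (simp del: G.nat_pow_Suc)
    finally have shift: "(\<Prod>j\<in>{..< G.ord z}. f (z [^] Suc j, x)) = Q" ..
    have "f (z [^] j, x) * f (z, z [^] j \<otimes> x) = f (z [^] Suc j, x) * f (z, z [^] j)" for j :: nat
      using eq[of z "z [^] j" x] x G.nat_pow_Suc2[of z j] by (simp del: G.nat_pow_Suc)
    then have "(\<Prod>j\<in>{..< G.ord z}. f (z [^] j, x) * f (z, z [^] j \<otimes> x))
        = (\<Prod>j\<in>{..< G.ord z}. f (z [^] Suc j, x) * f (z, z [^] j))"
      by (intro prod.cong) (simp_all del: G.nat_pow_Suc)
    then have "Q * (\<Prod>j\<in>{..< G.ord z}. f (z, z [^] j \<otimes> x)) = Q * P"
      unfolding prod.distrib shift by (simp add: Q_def P_def)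
    moreover have "Q \<noteq> 0" unfolding Q_def using nz x by simp
    ultimately show ?thesis by simp
  qed
  have "P \<noteq> 0" unfolding P_def using nz by simp
  have "card {c. c ^ G.ord z = inverse P} > 0"
    using card_nth_roots[of "inverse P" "G.ord z"] m \<open>P \<noteq> 0\<close> by simp
  then obtain c where c: "c ^ G.ord z = inverse P"
    by (auto simp: card_gt_0_iff)
  then have "c \<noteq> 0" using m \<open>P \<noteq> 0\<close> by (auto simp: power_0_left)
  have "(\<Prod>j\<in>{..< G.ord z}. c * f (z, z [^] j \<otimes> x)) = 1" if "x \<in> carrier G" for x
    using P_const[OF that] c \<open>P \<noteq> 0\<close> by (simp add: prod.distrib)
  then obtain g where g: "\<And>x. x \<in> carrier G \<Longrightarrow> g x \<noteq> 0"
    and gz: "\<And>x. x \<in> carrier G \<Longrightarrow> g (z \<otimes> x) = c * f (z, x) * g x"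
    using G.twisted_equivariant_function[OF finite_G z_closed, of "\<lambda>x. c * f (z, x)"] nz \<open>c \<noteq> 0\<close>
    by auto
  define F where "F x y = f (x, y) * g x * g y / g (x \<otimes> y)" for x y
  have F1: "F (z \<otimes> x) y = F x y" if xy: "x \<in> carrier G" "y \<in> carrier G" for x y
  proof -
    have "F (z \<otimes> x) y = (f (z \<otimes> x, y) * f (z, x)) * (g x * g y) / (f (z, x \<otimes> y) * g (x \<otimes> y))"
      using xy \<open>c \<noteq> 0\<close> by (simp add: F_def gz G.m_assoc)
    also have "\<dots> = F x y"
      using eq[of z x y] nz[of z "x \<otimes> y"] xy by (simp add: F_def flip: eq)
    finally show ?thesis .
  qed
  have F2: "F x (z \<otimes> y) = F x y" if xy: "x \<in> carrier G" "y \<in> carrier G" for x y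
  proof -
    have xzy: "x \<otimes> (z \<otimes> y) = z \<otimes> (x \<otimes> y)" "x \<otimes> z = z \<otimes> x"
      using xy z_comm[of x] by (simp_all flip: G.m_assoc)
    have "F x (z \<otimes> y) = (f (z, y) * f (x, z \<otimes> y)) * (g x * g y) / (f (z, x \<otimes> y) * g (x \<otimes> y))"
      using xy \<open>c \<noteq> 0\<close> by (simp add: F_def gz xzy)
    \<comment> \<open>The identities at (x, z, y) and (z, x, y), linked by f(x, z) = f(z,
      x).\<close>
    also have "f (z, y) * f (x, z \<otimes> y) = f (x, y) * f (z, x \<otimes> y)"
      using eq[of x z y] eq[of z x y] xy sym[of x] xzy(2) by simp
    finally show ?thesis
      using nz[of z "x \<otimes> y"] xy by (simp add: F_def)
  qed
  have Fnz: "F x y \<noteq> 0" if "x \<in> carrier G" "y \<in> carrier G" for x y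
    using that nz g by (simp add: F_def)
  have Feq: "F y w * F x (y \<otimes> w) = F (x \<otimes> y) w * F x y"
    if xyw: "x \<in> carrier G" "y \<in> carrier G" "w \<in> carrier G" for x y w
  proof -
    have "F y w * F x (y \<otimes> w)
        = (f (y, w) * f (x, y \<otimes> w)) * (g x * g y * g w / g (x \<otimes> y \<otimes> w))"
      using g xyw by (simp add: F_def G.m_assoc)
    also have "\<dots> = (f (x \<otimes> y, w) * f (x, y)) * (g x * g y * g w / g (x \<otimes> y \<otimes> w))"
      unfolding eq[OF xyw] ..
    also have "\<dots> = F (x \<otimes> y) w * F x y"
      using g xyw by (simp add: F_def)
    finally show ?thesis .
  qed
  obtain f' where f': "f' \<in> cocycles H"
    and f'F: "\<And>x y. x \<in> carrier G \<Longrightarrow> y \<in> carrier G \<Longrightarrow> f' (\<pi> x, \<pi> y) = F x y"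
    using descend_cocycle[of F, OF Fnz Feq F1 F2] by blast
  \<comment> \<open>The inverse of the coboundary of \<open>g\<close>, which turns \<open>F\<close>
    back into \<open>f\<close>.\<close>
  define b where "b = (\<lambda>(x, y)\<in>carrier G \<times> carrier G. g (x \<otimes> y) / (g x * g y))"
  have b: "b \<in> coboundaries2 G nonzero_complex"
    unfolding coboundaries_iff[OF G.is_group]
    by (intro conjI exI[of _ "\<lambda>x. inverse (g x)"]) (use g in \<open>auto simp: b_def field_simps\<close>)
  have "f = inflate f' \<otimes>\<^bsub>cocycle_group G\<^esub> b"
    unfolding mult_cocycle_group
    by (rule extensionalityI[of _ "carrier G \<times> carrier G"])
      (use f g in \<open>auto simp: cocycles_iff inflate_def b_def f'F F_def\<close>)
  moreover have "b \<in> cocycles G" using b coboundaries_subset[OF G.is_group] by blast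
  ultimately have "cocycle_class G f
      = cocycle_class G (inflate f') \<otimes>\<^bsub>schur_multiplier G\<^esub> cocycle_class G b"
    using Group.hom_mult[OF cocycle_class_hom[OF G.is_group]] inflate_closed[OF f'] by simp
  also have "cocycle_class G b = \<one>\<^bsub>schur_multiplier G\<^esub>"
    using cocycle_class_eq_one_iff[OF G.is_group \<open>b \<in> cocycles G\<close>] b by simp
  finally have "cocycle_class G f = cocycle_class G (inflate f')"
  proof -
    assume *: "cocycle_class G f
      = cocycle_class G (inflate f') \<otimes>\<^bsub>schur_multiplier G\<^esub> \<one>\<^bsub>schur_multiplier G\<^esub>"
    interpret M: comm_group "schur_multiplier G"
      by (rule comm_group_schur_multiplier) (rule G.is_group)
    show ?thesis
      using * inflate_closed[OF f'] by (simp add: carrier_schur_multiplier)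
  qed
  with f' show thesis by (rule that)
qed

text \<open>A function on \<open>G\<close> on which \<open>z\<close> acts by a nontrivial root of unity \<open>\<zeta>\<close> has a coboundary that is
  the inflation of a cocycle of \<open>H\<close>. Were the latter a coboundary, \<open>G\<close> would have a linear character
  with value \<open>\<zeta>\<close> at \<open>z\<close>.\<close>
lemma class_killed_by_inflation:
  assumes p: "Factorial_Ring.prime p" and ord: "G.ord z = p" and der: "z \<in> derived G (carrier G)"
  obtains f where "f \<in> cocycles H" "cocycle_class G (inflate f) = \<one>\<^bsub>schur_multiplier G\<^esub>"
    "group.ord (schur_multiplier H) (cocycle_class H f) = p"
proof -
  have p1: "p > 1" using p by (rule prime_gt_1_nat)
  have "\<not> {\<zeta>::complex. \<zeta> ^ p = 1} \<subseteq> {1}"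
  proof
    assume "{\<zeta>::complex. \<zeta> ^ p = 1} \<subseteq> {1}"
    then have "card {\<zeta>::complex. \<zeta> ^ p = 1} \<le> card {1::complex}"
      by (intro card_mono) simp
    moreover have "card {\<zeta>::complex. \<zeta> ^ p = 1} = p"
      using p1 by (intro card_roots_unity_eq) simp
    ultimately show False using p1 by simp
  qed
  then obtain \<zeta> :: complex where \<zeta>: "\<zeta> ^ p = 1" "\<zeta> \<noteq> 1" by blast
  have \<zeta>0: "\<zeta> \<noteq> 0"
  proof
    assume "\<zeta> = 0"
    with \<zeta>(1) p1 show False by (simp add: power_0_left)
  qed
  \<comment> \<open>A full period multiplies by \<zeta>^p = 1, so the constant twist closes
    up.\<close>
  obtain g where g: "\<And>x. x \<in> carrier G \<Longrightarrow> g x \<noteq> 0"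
    and gz: "\<And>x. x \<in> carrier G \<Longrightarrow> g (z \<otimes> x) = \<zeta> * g x"
    using G.twisted_equivariant_function[OF finite_G z_closed, of "\<lambda>_. \<zeta>"] \<zeta> \<zeta>0 ord by auto
  define F where "F x y = g x * g y / g (x \<otimes> y)" for x y
  have F1: "F (z \<otimes> x) y = F x y" if xy: "x \<in> carrier G" "y \<in> carrier G" for x y
    using xy g \<zeta>0 by (simp add: F_def gz G.m_assoc)
  have F2: "F x (z \<otimes> y) = F x y" if xy: "x \<in> carrier G" "y \<in> carrier G" for x y
  proof -
    have "x \<otimes> (z \<otimes> y) = z \<otimes> (x \<otimes> y)"
      using xy z_comm[of x] by (simp flip: G.m_assoc)
    then show ?thesis using xy g \<zeta>0 by (simp add: F_def gz)
  qed
  have Fnz: "F x y \<noteq> 0" if "x \<in> carrier G" "y \<in> carrier G" for x y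
    using that g by (simp add: F_def)
  have Feq: "F y w * F x (y \<otimes> w) = F (x \<otimes> y) w * F x y"
    if xyw: "x \<in> carrier G" "y \<in> carrier G" "w \<in> carrier G" for x y w
    using g xyw by (simp add: F_def G.m_assoc)
  obtain f where f: "f \<in> cocycles H"
    and fF: "\<And>x y. x \<in> carrier G \<Longrightarrow> y \<in> carrier G \<Longrightarrow> f (\<pi> x, \<pi> y) = F x y"
    using descend_cocycle[of F, OF Fnz Feq F1 F2] by blast
  interpret MH: comm_group "schur_multiplier H"
    by (rule comm_group_schur_multiplier) (rule H.is_group)
  interpret ch: group_hom "cocycle_group H" "schur_multiplier H" "cocycle_class H"
    using comm_group.axioms(2)[OF comm_group_cocycle_group[OF H.is_group]] MH.is_group
      cocycle_class_hom[OF H.is_group]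
    by (simp add: group_hom_def group_hom_axioms_def)
  have "inflate f \<in> coboundaries2 G nonzero_complex"
    unfolding coboundaries_iff[OF G.is_group]
    by (intro conjI exI[of _ g]) (use g in \<open>auto simp: inflate_def fF F_def\<close>)
  then have 1: "cocycle_class G (inflate f) = \<one>\<^bsub>schur_multiplier G\<^esub>"
    using cocycle_class_eq_one_iff[OF G.is_group inflate_closed[OF f]] by simp
  have "cocycle_class H f \<noteq> \<one>\<^bsub>schur_multiplier H\<^esub>"
  proof
    assume "cocycle_class H f = \<one>\<^bsub>schur_multiplier H\<^esub>"
    then have "f \<in> coboundaries2 H nonzero_complex"
      using cocycle_class_eq_one_iff[OF H.is_group f] by simp
    then obtain e where e: "\<And>x. x \<in> carrier H \<Longrightarrow> e x \<noteq> 0"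
      and fe: "\<And>x y. x \<in> carrier H \<Longrightarrow> y \<in> carrier H \<Longrightarrow> f (x, y) * e (x \<otimes>\<^bsub>H\<^esub> y) = e x * e y"
      unfolding coboundaries_iff[OF H.is_group] by blast
    \<comment> \<open>\<open>F\<close> is the coboundary of \<open>g\<close> and also that of
      \<open>e\<close> pulled back to \<open>G\<close>, so the ratio is multiplicative.\<close>
    have hom: "(\<lambda>x. g x / e (\<pi> x)) \<in> hom G nonzero_complex"
    proof (rule homI)
      fix x y assume xy: "x \<in> carrier G" "y \<in> carrier G"
      have 1: "F x y * e (\<pi> x \<otimes>\<^bsub>H\<^esub> \<pi> y) = e (\<pi> x) * e (\<pi> y)"
        using fe[of "\<pi> x" "\<pi> y"] xy by (simp add: fF)
      have nz: "e (\<pi> x) \<noteq> 0" "e (\<pi> y) \<noteq> 0" "e (\<pi> x \<otimes>\<^bsub>H\<^esub> \<pi> y) \<noteq> 0"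
        "g x \<noteq> 0" "g y \<noteq> 0" "g (x \<otimes> y) \<noteq> 0" using xy e g by simp_all
      have "g x * g y / (e (\<pi> x) * e (\<pi> y)) = g (x \<otimes> y) / e (\<pi> x \<otimes>\<^bsub>H\<^esub> \<pi> y)"
        unfolding 1[symmetric] using nz by (simp add: F_def)
      then show "g (x \<otimes> y) / e (\<pi> (x \<otimes> y))
          = g x / e (\<pi> x) \<otimes>\<^bsub>nonzero_complex\<^esub> (g y / e (\<pi> y))"
        using xy by simp
    qed (use g e in simp)
    have "g z / e (\<pi> z) = 1"
      using G.nonzero_complex_hom_eq_one_on_derived[OF hom der] .
    moreover have "g \<one> / e \<one>\<^bsub>H\<^esub> = 1"
      using Group.hom_one[OF hom G.is_group group_nonzero_complex] by simp
    moreover have "g z = \<zeta> * g \<one>" using gz[of \<one>] by simp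
    ultimately show False using \<zeta>(2) by simp
  qed
  then have "MH.ord (cocycle_class H f) \<noteq> 1"
    using MH.ord_eq_1 f by (simp add: carrier_schur_multiplier)
  moreover have "MH.ord (cocycle_class H f) dvd p"
  proof -
    \<comment> \<open>The p-th power removes \<zeta>, so g^p is constant on fibres and exhibits f^p
      as a coboundary on \<open>H\<close>.\<close>
    have gp: "g (lift (\<pi> x)) ^ p = g x ^ p" if "x \<in> carrier G" for x
      by (rule fibrewise_constant[of "\<lambda>x. g x ^ p"])
        (use that \<zeta> in \<open>auto simp: gz power_mult_distrib lift_closed image_lift\<close>)
    have pw: "f (a, b) ^ p * g (lift (a \<otimes>\<^bsub>H\<^esub> b)) ^ p = g (lift a) ^ p * g (lift b) ^ p"
      if ab: "a \<in> carrier H" "b \<in> carrier H" for a b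
    proof -
      obtain x y where xy: "x \<in> carrier G" "y \<in> carrier G" and a: "a = \<pi> x" "b = \<pi> y"
        using ab unfolding surj[symmetric] by blast
      have "F x y ^ p * g (x \<otimes> y) ^ p = g x ^ p * g y ^ p"
        using xy g by (simp add: F_def power_divide power_mult_distrib)
      then show ?thesis
        unfolding a using xy gp[of "x \<otimes> y"] by (simp add: fF gp)
    qed
    have "(\<lambda>i\<in>carrier H \<times> carrier H. f i ^ p) \<in> coboundaries2 H nonzero_complex"
      unfolding coboundaries_iff[OF H.is_group]
      by (intro conjI exI[of _ "\<lambda>a. g (lift a) ^ p"]) (use g pw in \<open>auto simp: lift_closed\<close>)
    then have "cocycle_class H (f [^]\<^bsub>cocycle_group H\<^esub> p) = \<one>\<^bsub>schur_multiplier H\<^esub>"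
      unfolding pow_cocycle_group[OF H.is_group]
      using cocycle_class_eq_one_iff[OF H.is_group] coboundaries_subset[OF H.is_group] by blast
    then have "cocycle_class H f [^]\<^bsub>schur_multiplier H\<^esub> p = \<one>\<^bsub>schur_multiplier H\<^esub>"
      using f by (simp add: ch.hom_nat_pow)
    then show ?thesis
      using MH.pow_eq_id f by (simp add: carrier_schur_multiplier)
  qed
  ultimately have "MH.ord (cocycle_class H f) = p"
    using p by (metis prime_nat_iff)
  with f 1 show thesis by (rule that)
qed

text \<open>The factor \<open>p\<close> in the third claim is the gain from the kernel of inflation,
  which contains a class of order \<open>p\<close>. The characters in \<open>Q\<close> are
  restricted to the carrier, so that values elsewhere do not inflate the count.\<close>

lemma schur_multiplier_quotient_bound:
  fixes Q and p :: nat
  defines "Q \<equiv> (\<lambda>f. restrict (cpair f z) (carrier G)) ` cocycles G"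
  assumes finQ: "finite Q" and finH: "finite (carrier (schur_multiplier H))"
  shows "finite (carrier (schur_multiplier G))"
    and "order (schur_multiplier G) \<le> card Q * order (schur_multiplier H)"
    and "Factorial_Ring.prime p \<Longrightarrow> G.ord z = p \<Longrightarrow> z \<in> derived G (carrier G) \<Longrightarrow>
      p * order (schur_multiplier G) \<le> card Q * order (schur_multiplier H)"
proof -
  interpret MG: comm_group "schur_multiplier G"
    by (rule comm_group_schur_multiplier) (rule G.is_group)
  interpret MH: comm_group "schur_multiplier H"
    by (rule comm_group_schur_multiplier) (rule H.is_group)
  obtain \<iota> where \<iota>: "\<iota> \<in> hom (schur_multiplier H) (schur_multiplier G)"
    and \<iota>_class: "\<And>f. f \<in> cocycles H \<Longrightarrow> \<iota> (cocycle_class H f) = cocycle_class G (inflate f)"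
    using inflation_hom by blast
  interpret \<iota>: group_hom "schur_multiplier H" "schur_multiplier G" \<iota>
    using \<iota> by unfold_locales
  define I where "I = \<iota> ` carrier (schur_multiplier H)"
  define r where "r \<chi> = (SOME f. f \<in> cocycles G \<and> restrict (cpair f z) (carrier G) = \<chi>)" for \<chi>
  have r: "r \<chi> \<in> cocycles G \<and> restrict (cpair (r \<chi>) z) (carrier G) = \<chi>" if "\<chi> \<in> Q" for \<chi>
  proof -
    have "\<exists>f. f \<in> cocycles G \<and> restrict (cpair f z) (carrier G) = \<chi>"
      using that unfolding Q_def by blast
    then show ?thesis unfolding r_def by (rule someI_ex)
  qed
  \<comment> \<open>One cocycle is fixed per character. A class with the character \<chi> differs
    from the chosen one by the class of a cocycle with trivial character, and such a class is
    inflated.\<close>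
  have cover: "carrier (schur_multiplier G)
      \<subseteq> (\<lambda>(a, \<chi>). a \<otimes>\<^bsub>schur_multiplier G\<^esub> cocycle_class G (r \<chi>)) ` (I \<times> Q)"
  proof
    fix a assume "a \<in> carrier (schur_multiplier G)"
    then obtain f where f: "f \<in> cocycles G" and a: "a = cocycle_class G f"
      by (auto simp: carrier_schur_multiplier)
    define \<chi> where "\<chi> = restrict (cpair f z) (carrier G)"
    have \<chi>: "\<chi> \<in> Q" using f by (simp add: Q_def \<chi>_def)
    define f1 where "f1 = r \<chi>"
    have f1: "f1 \<in> cocycles G" and same: "restrict (cpair f1 z) (carrier G) = \<chi>"
      using r[OF \<chi>] by (simp_all add: f1_def)
    define d where "d = (\<lambda>i\<in>carrier G \<times> carrier G. f i / f1 i)"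
    have d: "d \<in> cocycles G"
    proof -
      have "(f (y, w) / f1 (y, w)) * (f (x, y \<otimes> w) / f1 (x, y \<otimes> w))
          = (f (x \<otimes> y, w) / f1 (x \<otimes> y, w)) * (f (x, y) / f1 (x, y))"
        if "x \<in> carrier G" "y \<in> carrier G" "w \<in> carrier G" for x y w
        unfolding times_divide_times_eq G.cocycle_eq[OF f that] G.cocycle_eq[OF f1 that] ..
      then show ?thesis
        using f f1 unfolding cocycles_iff by (simp add: d_def)
    qed
    have "d (z, x) = d (x, z)" if x: "x \<in> carrier G" for x
    proof -
      have "cpair f z x = cpair f1 z x"
        using fun_cong[OF same, of x] x by (simp add: \<chi>_def)
      then show ?thesis
        using x G.cocycle_nonzero[OF f] G.cocycle_nonzero[OF f1]
        by (simp add: cpair_def d_def field_simps)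
    qed
    then obtain f' where f': "f' \<in> cocycles H" "cocycle_class G d = cocycle_class G (inflate f')"
      using class_eq_inflated[OF d] by blast
    have "f = d \<otimes>\<^bsub>cocycle_group G\<^esub> f1"
      unfolding mult_cocycle_group
      by (rule extensionalityI[of _ "carrier G \<times> carrier G"])
        (use f G.cocycle_nonzero[OF f1] in \<open>auto simp: cocycles_iff d_def\<close>)
    then have "a = cocycle_class G d \<otimes>\<^bsub>schur_multiplier G\<^esub> cocycle_class G f1"
      unfolding a using Group.hom_mult[OF cocycle_class_hom[OF G.is_group]] d f1 by simp
    moreover have "cocycle_class G d \<in> I"
      using f' \<iota>_class[OF f'(1)] by (auto simp: I_def carrier_schur_multiplier)
    ultimately show "a \<in> (\<lambda>(a, \<chi>). a \<otimes>\<^bsub>schur_multiplier G\<^esub> cocycle_class G (r \<chi>)) ` (I \<times> Q)"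
      using \<chi> by (force simp: f1_def)
  qed
  have finI: "finite I" unfolding I_def using finH by simp
  show fin: "finite (carrier (schur_multiplier G))"
    by (rule finite_subset[OF cover]) (use finQ finI in simp)
  have bound: "order (schur_multiplier G) \<le> card I * card Q"
    unfolding order_def using surj_card_le[OF _ cover] finQ finI by (simp add: card_cartesian_product)
  have I: "card I * card (Coset.kernel (schur_multiplier H) (schur_multiplier G) \<iota>) = order (schur_multiplier H)"
    unfolding I_def by (rule \<iota>.card_image_mult_card_kernel)
  have fin_ker: "finite (Coset.kernel (schur_multiplier H) (schur_multiplier G) \<iota>)"
    using finH by (auto simp: kernel_def)
  \<comment> \<open>Applied with q = 1 for an arbitrary \<open>z\<close>, and with q = p for
    \<open>z\<close> of order \<open>p\<close> in the derived subgroup.\<close>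
  have scale: "q * order (schur_multiplier G) \<le> card Q * order (schur_multiplier H)"
    if "q \<le> card (Coset.kernel (schur_multiplier H) (schur_multiplier G) \<iota>)" for q
  proof -
    have "q * order (schur_multiplier G)
        \<le> card (Coset.kernel (schur_multiplier H) (schur_multiplier G) \<iota>) * (card I * card Q)"
      using that bound by (rule mult_le_mono)
    also have "\<dots> = card Q * order (schur_multiplier H)"
      unfolding I[symmetric] by (simp add: ac_simps)
    finally show ?thesis .
  qed
  have "\<one>\<^bsub>schur_multiplier H\<^esub> \<in> Coset.kernel (schur_multiplier H) (schur_multiplier G) \<iota>"
    by (simp add: kernel_def)
  then have "1 \<le> card (Coset.kernel (schur_multiplier H) (schur_multiplier G) \<iota>)"
    using fin_ker by (metis One_nat_def Suc_leI card_gt_0_iff empty_iff)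
  from scale[OF this] show "order (schur_multiplier G) \<le> card Q * order (schur_multiplier H)" by simp
  show "p * order (schur_multiplier G) \<le> card Q * order (schur_multiplier H)"
    if p: "Factorial_Ring.prime p" "G.ord z = p" "z \<in> derived G (carrier G)"
  proof (rule scale)
    obtain f where f: "f \<in> cocycles H" "cocycle_class G (inflate f) = \<one>\<^bsub>schur_multiplier G\<^esub>"
      "MH.ord (cocycle_class H f) = p"
      using class_killed_by_inflation[OF p] by blast
    then have a: "cocycle_class H f \<in> Coset.kernel (schur_multiplier H) (schur_multiplier G) \<iota>"
      using \<iota>_class[OF f(1)] by (auto simp: kernel_def carrier_schur_multiplier)
    then have "p = card (generate (schur_multiplier H) {cocycle_class H f})"
      using MH.generate_pow_card[of "cocycle_class H f"] f(3) by (simp add: kernel_def)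
    also have "\<dots> \<le> card (Coset.kernel (schur_multiplier H) (schur_multiplier G) \<iota>)"
      by (intro card_mono fin_ker MH.generate_subgroup_incl \<iota>.subgroup_kernel) (use a in simp)
    finally show "p \<le> card (Coset.kernel (schur_multiplier H) (schur_multiplier G) \<iota>)" .
  qed
qed

end

lemma central_cyclic_quotientI:
  assumes "group G" "finite (carrier G)" "group H" "\<pi> \<in> hom G H" "\<pi> ` carrier G = carrier H"
    and "z \<in> group_center G" "Coset.kernel G H \<pi> = generate G {z}"
  shows "central_cyclic_quotient G H \<pi> z"
  using assms
  by (simp add: central_cyclic_quotient_def central_cyclic_quotient_axioms_def group_hom_def
      group_hom_axioms_def)

lemma card_functions_determined_by_roots_of_unity:
  fixes Q :: "('a \<Rightarrow> complex) set"
  assumes T: "finite T" and m: "m > 0"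
    and roots: "\<And>\<chi> t. \<chi> \<in> Q \<Longrightarrow> t \<in> T \<Longrightarrow> \<chi> t ^ m = 1"
    and det: "\<And>\<chi> \<chi>'. \<chi> \<in> Q \<Longrightarrow> \<chi>' \<in> Q \<Longrightarrow> (\<And>t. t \<in> T \<Longrightarrow> \<chi> t = \<chi>' t) \<Longrightarrow> \<chi> = \<chi>'"
  shows "finite Q" and "card Q \<le> m ^ card T"
proof -
  let ?R = "\<lambda>\<chi>. restrict \<chi> T" and ?S = "T \<rightarrow>\<^sub>E {u::complex. u ^ m = 1}"
  have inj: "inj_on ?R Q"
  proof (rule inj_onI)
    fix \<chi> \<chi>' assume *: "\<chi> \<in> Q" "\<chi>' \<in> Q" "?R \<chi> = ?R \<chi>'"
    have "\<chi> t = \<chi>' t" if "t \<in> T" for t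
      using fun_cong[OF *(3), of t] that by simp
    then show "\<chi> = \<chi>'" using det[OF *(1,2)] by blast
  qed
  have img: "?R ` Q \<subseteq> ?S" using roots by auto
  have fin: "finite ?S" using T finite_nth_roots[OF m, of 1] by (intro finite_PiE) auto
  show "finite Q" using finite_imageD[OF finite_subset[OF img fin] inj] .
  have "card Q \<le> card ?S" using card_inj_on_le[OF inj img fin] .
  also have "card ?S = m ^ card T"
    using T card_roots_unity_eq[OF m] by (simp add: card_PiE)
  finally show "card Q \<le> m ^ card T" .
qed

section \<open>Counting the characters attached to a central element\<close>

lemma (in group) homs_agree_on_generators:
  assumes "group K" "h \<in> hom G K" "h' \<in> hom G K" and S: "S \<subseteq> carrier G" "generate G S = carrier G"
    and eq: "\<And>s. s \<in> S \<Longrightarrow> h s = h' s" and x: "x \<in> carrier G"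
  shows "h x = h' x"
proof -
  interpret K: group K by fact
  interpret h: group_hom G K h using assms(2) by unfold_locales
  interpret h': group_hom G K h' using assms(3) by unfold_locales
  have "subgroup {x \<in> carrier G. h x = h' x} G"
    by (rule subgroupI) auto
  then have "generate G S \<subseteq> {x \<in> carrier G. h x = h' x}"
    by (intro generate_subgroup_incl) (use S eq in auto)
  with S x show ?thesis by auto
qed

context central_cyclic_quotient
begin

text \<open>Only the values on \<open>T\<close> are free, and each is a root of unity of order
  dividing that of \<open>z\<close>. The set \<open>S\<close> absorbs the generators with trivial
  value: it will be the center, the centralizer of two elements, {z} or the whole group.\<close>

lemma card_characters_le:
  fixes m :: nat
  defines "Q \<equiv> (\<lambda>f. restrict (cpair f z) (carrier G)) ` cocycles G"
  assumes T: "finite T" "T \<subseteq> carrier G" and S: "S \<subseteq> carrier G"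
    and gen: "generate G (T \<union> S) = carrier G"
    and trivial: "\<And>f s. f \<in> cocycles G \<Longrightarrow> s \<in> S \<Longrightarrow> cpair f z s = 1"
  shows "finite Q" and "card Q \<le> G.ord z ^ card T"
proof -
  note * = card_functions_determined_by_roots_of_unity[OF T(1), where m = "G.ord z" and Q = Q]
  have m: "G.ord z > 0" using G.ord_ge_1[OF finite_G z_closed] by simp
  have roots: "\<chi> t ^ G.ord z = 1" if "\<chi> \<in> Q" "t \<in> T" for \<chi> t
  proof -
    obtain f where f: "f \<in> cocycles G" and \<chi>: "\<chi> = restrict (cpair f z) (carrier G)"
      using \<open>\<chi> \<in> Q\<close> unfolding Q_def by blast
    have t: "t \<in> carrier G" using T that by blast
    \<comment> \<open>The pairing is multiplicative in the argument \<open>z\<close> as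
      well.\<close>
    have "cpair f z t ^ G.ord z = cpair f (z [^] G.ord z) t"
      by (rule G.cpair_pow[OF f z_closed t z_comm[OF t], symmetric])
    then show ?thesis using t G.cpair_one[OF f t] by (simp add: \<chi>)
  qed
  have det: "\<chi> = \<chi>'" if "\<chi> \<in> Q" "\<chi>' \<in> Q" and eq: "\<And>t. t \<in> T \<Longrightarrow> \<chi> t = \<chi>' t" for \<chi> \<chi>'
  proof -
    obtain f where f: "f \<in> cocycles G" and \<chi>: "\<chi> = restrict (cpair f z) (carrier G)"
      using \<open>\<chi> \<in> Q\<close> unfolding Q_def by blast
    obtain f' where f': "f' \<in> cocycles G" and \<chi>': "\<chi>' = restrict (cpair f' z) (carrier G)"
      using \<open>\<chi>' \<in> Q\<close> unfolding Q_def by blast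
    have "cpair f z t = cpair f' z t" if t: "t \<in> T \<union> S" for t
    proof (cases "t \<in> S")
      case True
      then show ?thesis using trivial f f' by simp
    next
      case False
      then have "t \<in> T" "t \<in> carrier G" using t T by auto
      then show ?thesis using eq[of t] by (simp add: \<chi> \<chi>')
    qed
    then have "cpair f z x = cpair f' z x" if "x \<in> carrier G" for x
      using G.homs_agree_on_generators[OF group_nonzero_complex G.cpair_central_hom(2)[OF f central]
        G.cpair_central_hom(2)[OF f' central] _ gen _ that] T S by blast
    then show ?thesis unfolding \<chi> \<chi>' by (intro restrict_ext) simp
  qed
  show "finite Q" by (rule *(1)[OF m]) (fact roots, fact det)
  show "card Q \<le> G.ord z ^ card T" by (rule *(2)[OF m]) (fact roots, fact det)
qed

text \<open>The roles are exchanged: for a fixed central \<open>s\<close> the function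
  \<open>\<lambda>x. cpair f x s\<close> is a linear character of all of \<open>G\<close>, hence
  trivial at \<open>z\<close>. So the character attached to \<open>z\<close> factors through
  G/Z(G).\<close>

lemma cpair_z_center:
  assumes f: "f \<in> cocycles G" and s: "s \<in> group_center G" and z: "z \<in> derived G (carrier G)"
  shows "cpair f z s = 1"
  using G.nonzero_complex_hom_eq_one_on_derived[OF G.cpair_central_hom(1)[OF f s] z] .

text \<open>There are at most p^(e+1) characters, and the kernel of inflation pays for one factor
  \<open>p\<close>. A mere upper bound on \<open>card T\<close> is asked for, since images of
  \<open>T\<close> in quotients may shrink.\<close>

lemma schur_multiplier_bound_modulo_center:
  fixes p :: nat
  assumes finH: "finite (carrier (schur_multiplier H))"
    and p: "Factorial_Ring.prime p" "G.ord z = p" and z: "z \<in> derived G (carrier G)"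
    and T: "finite T" "T \<subseteq> carrier G" "card T \<le> Suc e"
    and gen: "generate G (T \<union> group_center G) = carrier G"
  shows "finite (carrier (schur_multiplier G))"
    and "order (schur_multiplier G) \<le> p ^ e * order (schur_multiplier H)"
proof -
  have C: "group_center G \<subseteq> carrier G" by (auto simp: group_center_def)
  have trivial: "cpair f z s = 1" if "f \<in> cocycles G" "s \<in> group_center G" for f s
    using cpair_z_center[OF that z] .
  let ?Q = "(\<lambda>f. restrict (cpair f z) (carrier G)) ` cocycles G"
  have Q: "finite ?Q" "card ?Q \<le> G.ord z ^ card T"
    by (rule card_characters_le[OF T(1,2) C gen], fact trivial)+
  note bound = schur_multiplier_quotient_bound[OF Q(1) finH]
  show "finite (carrier (schur_multiplier G))" by (rule bound(1))
  have p0: "p > 0" using p(1) by (simp add: prime_gt_0_nat)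
  have "p * order (schur_multiplier G)
      \<le> card ?Q * order (schur_multiplier H)"
    by (rule bound(3)[OF p z])
  also have "\<dots> \<le> p ^ card T * order (schur_multiplier H)"
    using Q(2) unfolding p(2) by (rule mult_le_mono1)
  also have "\<dots> \<le> p ^ Suc e * order (schur_multiplier H)"
    using T(3) p0 by (intro mult_le_mono1 power_increasing) auto
  finally show "order (schur_multiplier G) \<le> p ^ e * order (schur_multiplier H)"
    using p0 by simp
qed

text \<open>If \<open>w\<close> centralizes \<open>x\<close> and \<open>y\<close>, a lift of \<open>w\<close> to the extension defined by a cocycle acts on
  lifts of \<open>x\<close> and \<open>y\<close> by scalars, so it commutes with their commutator. Hence the character attached
  to \<open>z = [x, y]\<close> is determined by its values at \<open>x\<close> and \<open>y\<close>.\<close>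
lemma schur_multiplier_bound_commutator:
  fixes p :: nat
  assumes finH: "finite (carrier (schur_multiplier H))"
    and p: "Factorial_Ring.prime p" "G.ord z = p"
    and xy: "x \<in> carrier G" "y \<in> carrier G" and zxy: "z = x \<otimes> y \<otimes> inv x \<otimes> inv y"
    and der: "derived G (carrier G) = generate G {z}"
  shows "finite (carrier (schur_multiplier G))"
    and "order (schur_multiplier G) \<le> p * order (schur_multiplier H)"
proof -
  \<comment> \<open>The centralizer of \<open>x\<close> and \<open>y\<close>, on which the character
    attached to \<open>z\<close> is trivial. Together with \<open>x\<close> and \<open>y\<close> it
    generates \<open>G\<close>: all commutators are powers of the central \<open>z\<close>, so those
    of an element with \<open>x\<close> and \<open>y\<close> can be compensated.\<close>
  define C where "C = {w \<in> carrier G. x \<otimes> w = w \<otimes> x \<and> y \<otimes> w = w \<otimes> y}"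
  have p0: "p > 0" using p(1) by (simp add: prime_gt_0_nat)
  have zk: "z [^] k \<otimes> u = u \<otimes> z [^] k" if "u \<in> carrier G" for u and k :: nat
  proof (induction k)
    case (Suc k)
    then show ?case using that z_comm[OF that] by (metis G.m_assoc G.nat_pow_Suc G.nat_pow_closed z_closed)
  qed (use that in simp)
  have comm: "\<exists>a::nat. u \<otimes> w = z [^] a \<otimes> (w \<otimes> u)" if "u \<in> carrier G" "w \<in> carrier G" for u w
  proof -
    have "u \<otimes> w \<otimes> inv u \<otimes> inv w \<in> derived G (carrier G)"
      unfolding derived_def using that by (intro generate.incl) auto
    then obtain a :: nat where "u \<otimes> w \<otimes> inv u \<otimes> inv w = z [^] a"
      unfolding der using G.generate_pow_on_finite_carrier[OF finite_G z_closed] by auto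
    then have "u \<otimes> w \<otimes> inv u \<otimes> inv w \<otimes> (w \<otimes> u) = z [^] a \<otimes> (w \<otimes> u)" by simp
    moreover have "u \<otimes> w \<otimes> inv u \<otimes> inv w \<otimes> (w \<otimes> u) = u \<otimes> w"
      using that by (simp add: G.m_assoc G.inv_solve_left')
    ultimately show ?thesis by auto
  qed
  have xyz: "x \<otimes> y = z \<otimes> (y \<otimes> x)"
    unfolding zxy using xy by (simp add: G.m_assoc G.inv_solve_left')
  have xyj: "x \<otimes> y [^] j = z [^] j \<otimes> (y [^] j \<otimes> x)" for j :: nat
  proof (induction j)
    case (Suc j)
    have "x \<otimes> y [^] Suc j = (x \<otimes> y [^] j) \<otimes> y" using xy by (simp add: G.m_assoc)
    also have "\<dots> = z [^] j \<otimes> (y [^] j \<otimes> (x \<otimes> y))" unfolding Suc using xy by (simp add: G.m_assoc)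
    also have "\<dots> = z [^] j \<otimes> ((y [^] j \<otimes> z) \<otimes> (y \<otimes> x))" unfolding xyz using xy by (simp add: G.m_assoc)
    also have "y [^] j \<otimes> z = z \<otimes> y [^] j" using xy z_comm by simp
    finally show ?case using xy by (simp add: G.m_assoc)
  qed (use xy in simp)
  have yxi: "z [^] i \<otimes> (y \<otimes> x [^] i) = x [^] i \<otimes> y" for i :: nat
  proof (induction i)
    case (Suc i)
    have "z [^] Suc i \<otimes> (y \<otimes> x [^] Suc i) = z \<otimes> (z [^] i \<otimes> (y \<otimes> x [^] i)) \<otimes> x"
      using xy G.nat_pow_Suc2[of z i] by (simp add: G.m_assoc del: G.nat_pow_Suc)
    also have "\<dots> = (z \<otimes> x [^] i) \<otimes> (y \<otimes> x)" unfolding Suc using xy by (simp add: G.m_assoc)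
    also have "z \<otimes> x [^] i = x [^] i \<otimes> z" using xy z_comm by simp
    also have "x [^] i \<otimes> z \<otimes> (y \<otimes> x) = x [^] i \<otimes> (x \<otimes> y)" unfolding xyz using xy by (simp add: G.m_assoc)
    finally show ?case using xy by (simp add: G.m_assoc)
  qed (use xy in simp)
  have sub: "{x, y} \<union> C \<subseteq> carrier G" using xy by (auto simp: C_def)
  define D where "D = generate G ({x, y} \<union> C)"
  interpret K: subgroup D G
    unfolding D_def by (rule G.generate_is_subgroup[OF sub])
  have "w \<in> D" if w: "w \<in> carrier G" for w
  proof -
    obtain a where a: "x \<otimes> w = z [^] (a::nat) \<otimes> (w \<otimes> x)" using comm[OF xy(1) w] by blast
    obtain b where b: "y \<otimes> w = z [^] (b::nat) \<otimes> (w \<otimes> y)" using comm[OF xy(2) w] by blast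
    \<comment> \<open>A natural number in the role of -a modulo \<open>p\<close>.\<close>
    define j where "j = (p - 1) * a"
    have "a + j = p * a" unfolding j_def using p0 by (cases p) auto
    then have zaj: "z [^] a \<otimes> z [^] j = \<one>"
      using p(2) by (simp add: G.nat_pow_mult flip: G.nat_pow_pow) (metis G.nat_pow_one G.nat_pow_pow G.pow_ord_eq_1 z_closed)
    \<comment> \<open>The factor \<open>y [^] j\<close> undoes the commutator z^a of
      \<open>x\<close> with \<open>w\<close>, and \<open>x [^] b\<close> undoes the commutator z^b
      of \<open>y\<close> with \<open>w\<close>.\<close>
    define v where "v = w \<otimes> x [^] b \<otimes> y [^] j"
    have cl: "x [^] b \<in> carrier G" "y [^] j \<in> carrier G" "v \<in> carrier G" using xy w by (auto simp: v_def)
    have "x \<otimes> v = (x \<otimes> w) \<otimes> (x [^] b \<otimes> y [^] j)" using xy w by (simp add: v_def G.m_assoc)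
    also have "\<dots> = z [^] a \<otimes> (w \<otimes> (x \<otimes> x [^] b) \<otimes> y [^] j)" unfolding a using xy w by (simp add: G.m_assoc)
    also have "x \<otimes> x [^] b = x [^] b \<otimes> x" using xy G.nat_pow_Suc2[of x b] by simp
    also have "z [^] a \<otimes> (w \<otimes> (x [^] b \<otimes> x) \<otimes> y [^] j) = z [^] a \<otimes> (w \<otimes> x [^] b \<otimes> (x \<otimes> y [^] j))"
      using xy w by (simp add: G.m_assoc)
    also have "\<dots> = z [^] a \<otimes> (w \<otimes> x [^] b \<otimes> z [^] j \<otimes> (y [^] j \<otimes> x))"
      unfolding xyj using xy w by (simp add: G.m_assoc)
    also have "w \<otimes> x [^] b \<otimes> z [^] j = z [^] j \<otimes> (w \<otimes> x [^] b)" using zk[of "w \<otimes> x [^] b" j] xy w by simp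
    also have "z [^] a \<otimes> (z [^] j \<otimes> (w \<otimes> x [^] b) \<otimes> (y [^] j \<otimes> x)) = (z [^] a \<otimes> z [^] j) \<otimes> (v \<otimes> x)"
      using xy w by (simp add: v_def G.m_assoc)
    also have "\<dots> = v \<otimes> x" unfolding zaj using cl xy by simp
    finally have xv: "x \<otimes> v = v \<otimes> x" .
    have "y \<otimes> v = (y \<otimes> w) \<otimes> (x [^] b \<otimes> y [^] j)" using xy w by (simp add: v_def G.m_assoc)
    also have "\<dots> = (z [^] b \<otimes> w) \<otimes> (y \<otimes> x [^] b \<otimes> y [^] j)" unfolding b using xy w by (simp add: G.m_assoc)
    also have "z [^] b \<otimes> w = w \<otimes> z [^] b" by (rule zk[OF w])
    also have "w \<otimes> z [^] b \<otimes> (y \<otimes> x [^] b \<otimes> y [^] j) = w \<otimes> (z [^] b \<otimes> (y \<otimes> x [^] b)) \<otimes> y [^] j"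
      using xy w by (simp add: G.m_assoc)
    also have "\<dots> = w \<otimes> x [^] b \<otimes> (y \<otimes> y [^] j)" unfolding yxi using xy w by (simp add: G.m_assoc)
    also have "y \<otimes> y [^] j = y [^] j \<otimes> y" using xy G.nat_pow_Suc2[of y j] by simp
    finally have yv: "y \<otimes> v = v \<otimes> y" using xy w by (simp add: v_def G.m_assoc)
    have "v \<in> C" using xv yv cl by (simp add: C_def)
    then have gen: "v \<in> D" "x \<in> D" "y \<in> D"
      unfolding D_def by (auto intro: generate.incl)
    have pw: "u [^] (k::nat) \<in> D" if "u \<in> D" for u k
      by (induction k) (use that in auto)
    have "w = v \<otimes> inv (y [^] j) \<otimes> inv (x [^] b)"
      using xy w by (simp add: v_def G.m_assoc)
    also have "\<dots> \<in> D" using gen pw by auto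
    finally show ?thesis .
  qed
  then have gen: "generate G ({x, y} \<union> C) = carrier G" using K.subset by (auto simp: D_def)
  have trivial: "cpair f z s = 1" if "f \<in> cocycles G" "s \<in> C" for f s
    unfolding zxy using that by (intro G.cpair_commutator) (use xy in \<open>auto simp: C_def\<close>)
  have C: "C \<subseteq> carrier G" and T: "finite {x, y}" "{x, y} \<subseteq> carrier G" using xy by (auto simp: C_def)
  let ?Q = "(\<lambda>f. restrict (cpair f z) (carrier G)) ` cocycles G"
  have Q: "finite ?Q" "card ?Q \<le> G.ord z ^ card {x, y}"
    by (rule card_characters_le[OF T C gen], fact trivial)+
  note bound = schur_multiplier_quotient_bound[OF Q(1) finH]
  show "finite (carrier (schur_multiplier G))" by (rule bound(1))
  have "z \<in> derived G (carrier G)" unfolding der by (rule generate.incl) simp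
  note bound(3)[OF p this]
  also have "card ?Q * order (schur_multiplier H)
      \<le> p ^ card {x, y} * order (schur_multiplier H)"
    using Q(2) unfolding p(2) by (rule mult_le_mono1)
  \<comment> \<open>At most p^2 characters; the kernel of inflation pays for one of the two
    factors.\<close>
  also have "\<dots> \<le> p ^ 2 * order (schur_multiplier H)"
    using p0 by (intro mult_le_mono1 power_increasing) (auto simp: card_insert_if)
  finally show "order (schur_multiplier G) \<le> p * order (schur_multiplier H)"
    using p0 by (simp add: power2_eq_square)
qed

end

section \<open>Finite abelian groups\<close>

lemma trivial_group_schur_multiplier:
  assumes "group G" and triv: "carrier G = {\<one>\<^bsub>G\<^esub>}"
  shows "carrier (schur_multiplier G) = {\<one>\<^bsub>schur_multiplier G\<^esub>}"
proof -
  interpret group G by fact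
  have "cocycle_class G f = \<one>\<^bsub>schur_multiplier G\<^esub>" if f: "f \<in> cocycles G" for f
  proof -
    \<comment> \<open>On the trivial group a constant g has the coboundary g g / g = g, so the value
      of \<open>f\<close> itself is the witness.\<close>
    have "f \<in> coboundaries2 G nonzero_complex"
      unfolding coboundaries_iff[OF is_group]
      by (intro conjI exI[of _ "\<lambda>_. f (\<one>\<^bsub>G\<^esub>, \<one>\<^bsub>G\<^esub>)"]) (use f in \<open>auto simp: cocycles_iff triv\<close>)
    then show ?thesis using cocycle_class_eq_one_iff[OF is_group f] by simp
  qed
  moreover have "cocycles G \<noteq> {}"
    using subgroup.one_closed[OF subgroup_cocycles2[OF is_group comm_group_nonzero_complex]] by blast
  ultimately show ?thesis unfolding carrier_schur_multiplier by auto
qed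

text \<open>The product in the hypothesis on the abelianization, for general moduli in place of the
  p^(\<alpha> i). Modulus 0 would give the integers, hence the positivity assumed below.\<close>

definition cyclic_product :: "(nat \<Rightarrow> nat) \<Rightarrow> nat \<Rightarrow> (nat \<Rightarrow> int) monoid" where
  "cyclic_product m d = product_group {1..d} (\<lambda>i. integer_mod_group (m i))"

text \<open>The entry is reduced modulo \<open>m i\<close> because of the case \<open>m i = 1\<close>.\<close>
definition unit_vector :: "(nat \<Rightarrow> nat) \<Rightarrow> nat \<Rightarrow> nat \<Rightarrow> nat \<Rightarrow> int" where
  "unit_vector m d i = (\<lambda>j\<in>{1..d}. if j = i then 1 mod int (m i) else 0)"

context
  fixes m :: "nat \<Rightarrow> nat"
  assumes m: "\<And>i. m i > 0"
begin

lemma nonzero_modulus [simp]: "m i \<noteq> 0"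
  using m[of i] by simp

lemma mem_cyclic_product:
  "x \<in> carrier (cyclic_product m d) \<longleftrightarrow>
     x \<in> extensional {1..d} \<and> (\<forall>i\<in>{1..d}. 0 \<le> x i \<and> x i < int (m i))"
  by (auto simp: cyclic_product_def PiE_iff carrier_integer_mod_group)

lemma mult_cyclic_product [simp]:
  "x \<otimes>\<^bsub>cyclic_product m d\<^esub> y = (\<lambda>i\<in>{1..d}. (x i + y i) mod int (m i))"
  by (simp add: cyclic_product_def)

lemma one_cyclic_product [simp]: "\<one>\<^bsub>cyclic_product m d\<^esub> = (\<lambda>i\<in>{1..d}. 0)"
  by (simp add: cyclic_product_def)

lemma comm_group_cyclic_product: "comm_group (cyclic_product m d)"
  by (rule group.group_comm_groupI)
    (auto simp: cyclic_product_def add.commute intro!: restrict_ext)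

lemma finite_cyclic_product: "finite (carrier (cyclic_product m d))"
  by (auto simp: cyclic_product_def carrier_integer_mod_group intro!: finite_PiE)

lemma order_cyclic_product: "order (cyclic_product m d) = (\<Prod>i\<in>{1..d}. m i)"
  by (simp add: order_def cyclic_product_def card_PiE carrier_integer_mod_group)

lemma unit_vector_closed: "unit_vector m d i \<in> carrier (cyclic_product m d)"
  using m by (auto simp: mem_cyclic_product unit_vector_def)

lemma unit_vector_pow:
  "unit_vector m d i [^]\<^bsub>cyclic_product m d\<^esub> (k::nat) = (\<lambda>j\<in>{1..d}. if j = i then int k mod int (m i) else 0)"
proof (induction k)
  case 0
  show ?case by (auto simp: nat_pow_def fun_eq_iff)
next
  case (Suc k)
  interpret comm_group "cyclic_product m d" by (rule comm_group_cyclic_product)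
  have "unit_vector m d i [^]\<^bsub>cyclic_product m d\<^esub> Suc k
      = unit_vector m d i [^]\<^bsub>cyclic_product m d\<^esub> k \<otimes>\<^bsub>cyclic_product m d\<^esub> unit_vector m d i"
    by (rule nat_pow_Suc)
  also have "\<dots> = (\<lambda>j\<in>{1..d}. if j = i then int (Suc k) mod int (m i) else 0)"
    unfolding Suc mult_cyclic_product
    by (rule restrict_ext) (simp add: unit_vector_def mod_simps add.commute)
  finally show ?case .
qed

lemma generate_unit_vectors:
  "generate (cyclic_product m d) (unit_vector m d ` {1..d}) = carrier (cyclic_product m d)"
proof -
  interpret A: comm_group "cyclic_product m d" by (rule comm_group_cyclic_product)
  define D where "D = generate (cyclic_product m d) (unit_vector m d ` {1..d})"
  have sub: "unit_vector m d ` {1..d} \<subseteq> carrier (cyclic_product m d)"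
    using unit_vector_closed by blast
  interpret D: subgroup D "cyclic_product m d"
    unfolding D_def by (rule A.generate_is_subgroup[OF sub])
  have pow: "u [^]\<^bsub>cyclic_product m d\<^esub> (k::nat) \<in> D" if "u \<in> D" for u k
    by (induction k) (use that D.one_closed D.m_closed in \<open>simp_all only: A.nat_pow_0 A.nat_pow_Suc\<close>)
  \<comment> \<open>Induction on a bound \<open>j\<close> for the nonzero coordinates; each step
    splits off a power of one unit vector.\<close>
  have "x \<in> D" if "j \<le> d" "x \<in> carrier (cyclic_product m d)" "\<And>i. i \<in> {1..d} \<Longrightarrow> j < i \<Longrightarrow> x i = 0" for j x
    using that
  proof (induction j arbitrary: x)
    case 0
    have "x = \<one>\<^bsub>cyclic_product m d\<^esub>"
      by (rule extensionalityI[of _ "{1..d}"]) (use 0 in \<open>auto simp: mem_cyclic_product\<close>)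
    then show ?case using D.one_closed by (simp only:)
  next
    case (Suc j)
    have x: "x \<in> extensional {1..d}" "\<And>i. i \<in> {1..d} \<Longrightarrow> 0 \<le> x i \<and> x i < int (m i)"
      using Suc.prems(2) unfolding mem_cyclic_product by auto
    define y where "y = x(Suc j := 0)"
    have y: "y \<in> carrier (cyclic_product m d)"
      using x m Suc.prems(1) unfolding mem_cyclic_product by (auto simp: y_def extensional_def)
    have y0: "y i = 0" if "i \<in> {1..d}" "j < i" for i
      using Suc.prems(3)[of i] that by (auto simp: y_def)
    have "y \<in> D" by (rule Suc.IH[OF _ y y0]) (use Suc.prems(1) in simp)
    moreover have "unit_vector m d (Suc j) [^]\<^bsub>cyclic_product m d\<^esub> nat (x (Suc j)) \<in> D"
      using Suc.prems(1) by (intro pow) (auto simp: D_def intro!: generate.incl)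
    ultimately have "y \<otimes>\<^bsub>cyclic_product m d\<^esub> unit_vector m d (Suc j) [^]\<^bsub>cyclic_product m d\<^esub> nat (x (Suc j)) \<in> D"
      by (rule D.m_closed)
    moreover have "x = y \<otimes>\<^bsub>cyclic_product m d\<^esub> unit_vector m d (Suc j) [^]\<^bsub>cyclic_product m d\<^esub> nat (x (Suc j))"
      unfolding unit_vector_pow mult_cyclic_product
      by (rule extensionalityI[OF x(1)]) (use x(2) Suc.prems(1) in \<open>auto simp: y_def\<close>)
    ultimately show ?case by (rule ssubst[where P = "\<lambda>u. u \<in> D", rotated])
  qed
  then have "carrier (cyclic_product m d) \<subseteq> D"
    by (meson le_refl atLeastAtMost_iff not_le subsetI)
  then show ?thesis using D.subset by (auto simp: D_def)
qed

lemma central_cyclic_quotient_cyclic_product: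
  "central_cyclic_quotient (cyclic_product m (Suc d)) (cyclic_product m d)
     (\<lambda>x. restrict x {1..d}) (unit_vector m (Suc d) (Suc d))"
proof -
  let ?G = "cyclic_product m (Suc d)" and ?H = "cyclic_product m d"
    and ?\<pi> = "\<lambda>x. restrict x {1..d}" and ?z = "unit_vector m (Suc d) (Suc d)"
  interpret G: comm_group ?G by (rule comm_group_cyclic_product)
  interpret H: comm_group ?H by (rule comm_group_cyclic_product)
  have hom: "?\<pi> \<in> hom ?G ?H"
  proof (rule homI)
    show "?\<pi> x \<in> carrier ?H" if "x \<in> carrier ?G" for x
      using that unfolding mem_cyclic_product by auto
    show "?\<pi> (x \<otimes>\<^bsub>?G\<^esub> y) = ?\<pi> x \<otimes>\<^bsub>?H\<^esub> ?\<pi> y" for x y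
      unfolding mult_cyclic_product by (auto simp: fun_eq_iff)
  qed
  show ?thesis
  proof (intro_locales; unfold_locales)
    show "?\<pi> \<in> hom ?G ?H" by (rule hom)
    show "finite (carrier ?G)" by (rule finite_cyclic_product)
    show "?\<pi> ` carrier ?G = carrier ?H"
    proof
      show "?\<pi> ` carrier ?G \<subseteq> carrier ?H" using hom_carrier[OF hom] .
      show "carrier ?H \<subseteq> ?\<pi> ` carrier ?G"
      proof
        fix y assume y: "y \<in> carrier ?H"
        have "?\<pi> (y(Suc d := 0)) = y"
          by (rule extensionalityI[of _ "{1..d}"]) (use y in \<open>auto simp: mem_cyclic_product\<close>)
        moreover have "y(Suc d := 0) \<in> carrier ?G"
          using y m unfolding mem_cyclic_product by (auto simp: extensional_def)
        ultimately show "y \<in> ?\<pi> ` carrier ?G" by (metis image_eqI)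
      qed
    qed
    show "?z \<in> group_center ?G"
      using unit_vector_closed G.m_comm by (simp only: group_center_def) blast
    show "Coset.kernel ?G ?H ?\<pi> = generate ?G {?z}"
      unfolding G.generate_pow_on_finite_carrier[OF finite_cyclic_product unit_vector_closed]
    proof (intro equalityI subsetI)
      fix x assume "x \<in> Coset.kernel ?G ?H ?\<pi>"
      then have x: "x \<in> carrier ?G" and 0: "restrict x {1..d} = \<one>\<^bsub>?H\<^esub>" by (simp_all only: kernel_def mem_Collect_eq)
      have "x i = 0" if "i \<in> {1..d}" for i
        using fun_cong[OF 0, of i] that by simp
      moreover have "0 \<le> x (Suc d) \<and> x (Suc d) < int (m (Suc d))"
        using x unfolding mem_cyclic_product by simp
      ultimately have "x = ?z [^]\<^bsub>?G\<^esub> nat (x (Suc d))"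
        unfolding unit_vector_pow
        by (intro extensionalityI[of _ "{1..Suc d}"]) (use x in \<open>auto simp: mem_cyclic_product le_Suc_eq\<close>)
      then show "x \<in> {?z [^]\<^bsub>?G\<^esub> k |k. k \<in> (UNIV :: nat set)}" by blast
    next
      fix x assume "x \<in> {?z [^]\<^bsub>?G\<^esub> k |k. k \<in> (UNIV :: nat set)}"
      then obtain k :: nat where k: "x = ?z [^]\<^bsub>?G\<^esub> k" by blast
      then have "x \<in> carrier ?G" using unit_vector_closed by (simp only: G.nat_pow_closed)
      moreover have "restrict x {1..d} = \<one>\<^bsub>?H\<^esub>"
        unfolding k unit_vector_pow by (auto simp: fun_eq_iff)
      ultimately show "x \<in> Coset.kernel ?G ?H ?\<pi>" by (simp only: kernel_def mem_Collect_eq)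
    qed
  qed
qed

text \<open>When factor d + 1 is divided out, its generator pairs trivially with itself. A character
  is thus fixed by its values on the \<open>d\<close> other generators, each a root of unity of
  order dividing m (d + 1). The exponent i - 1 counts the earlier factors, so decreasing orders put
  the large exponents on the small factors.\<close>

lemma schur_multiplier_cyclic_product:
  "finite (carrier (schur_multiplier (cyclic_product m d)))
    \<and> order (schur_multiplier (cyclic_product m d)) \<le> (\<Prod>i\<in>{1..d}. m i ^ (i - 1))"
proof (induction d)
  case 0
  have "carrier (schur_multiplier (cyclic_product m 0)) = {\<one>\<^bsub>schur_multiplier (cyclic_product m 0)\<^esub>}"
    by (rule trivial_group_schur_multiplier)
      (auto simp: comm_group.axioms(2)[OF comm_group_cyclic_product] mem_cyclic_product restrict_def)
  then show ?case by (simp add: order_def)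
next
  case (Suc d)
  let ?G = "cyclic_product m (Suc d)" and ?z = "unit_vector m (Suc d) (Suc d)"
  interpret central_cyclic_quotient ?G "cyclic_product m d" "\<lambda>x. restrict x {1..d}" ?z
    by (rule central_cyclic_quotient_cyclic_product)
  let ?T = "unit_vector m (Suc d) ` {1..d}"
  have "{1..Suc d} = insert (Suc d) {1..d}" by auto
  then have gen: "generate ?G (?T \<union> {?z}) = carrier ?G"
    using generate_unit_vectors[of "Suc d"] by simp
  have T: "finite ?T" "?T \<subseteq> carrier ?G" and S: "{?z} \<subseteq> carrier ?G"
    using unit_vector_closed by blast+
  have "?z [^]\<^bsub>?G\<^esub> m (Suc d) = \<one>\<^bsub>?G\<^esub>"
    unfolding unit_vector_pow by (auto simp: fun_eq_iff)
  then have "G.ord ?z dvd m (Suc d)"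
    using G.pow_eq_id[OF unit_vector_closed] by blast
  then have ord: "G.ord ?z \<le> m (Suc d)" using m by (intro dvd_imp_le)
  have trivial: "cpair f ?z s = 1" if "f \<in> cocycles ?G" "s \<in> {?z}" for f s
    using that G.cpair_self by simp
  let ?Q = "(\<lambda>f. restrict (cpair f ?z) (carrier ?G)) ` cocycles ?G"
  have Q: "finite ?Q" "card ?Q \<le> G.ord ?z ^ card ?T"
    by (rule card_characters_le[OF T S gen], fact trivial)+
  have "card ?T \<le> d" using card_image_le[of "{1..d}" "unit_vector m (Suc d)"] by simp
  note bound = schur_multiplier_quotient_bound[OF Q(1) conjunct1[OF Suc.IH]]
  have "card ?Q \<le> m (Suc d) ^ d"
  proof -
    have "G.ord ?z ^ card ?T \<le> m (Suc d) ^ card ?T" using ord by (rule power_mono) simp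
    also have "\<dots> \<le> m (Suc d) ^ d" using \<open>card ?T \<le> d\<close> m[of "Suc d"] by (intro power_increasing) auto
    finally show ?thesis using Q(2) by simp
  qed
  then have "order (schur_multiplier ?G) \<le> m (Suc d) ^ d * (\<Prod>i\<in>{1..d}. m i ^ (i - 1))"
    using bound(2) conjunct2[OF Suc.IH] by (meson le_trans mult_le_mono)
  with bound(1) show ?case by (simp add: mult.commute)
qed

end

section \<open>Finite p-groups\<close>

context group
begin

text \<open>The class equation inside \<open>N\<close>: the noncentral elements fall into conjugacy
  classes of size divisible by \<open>p\<close>, and \<open>p\<close> divides the order of
  \<open>N\<close>, so \<open>N\<close> meets the center nontrivially.\<close>

lemma central_element_of_prime_order:
  assumes p: "Factorial_Ring.prime p" and ord: "order G = p ^ n" and N: "N \<lhd> G" and nt: "N \<noteq> {\<one>}"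
  obtains z where "z \<in> N" "z \<in> group_center G" "ord z = p"
proof -
  have p0: "p > 1" using p by (rule prime_gt_1_nat)
  then have "order G > 0" using ord by simp
  then have fin: "finite (carrier G)" by (simp add: order_gt_0_iff_finite)
  interpret N: normal N G by fact
  let ?\<phi> = "\<lambda>g. \<lambda>h\<in>carrier G. g \<otimes> h \<otimes> inv g"
  interpret act: group_action G "carrier G" ?\<phi> by (rule action_by_conjugation)
  have orbit_eq: "orbit G ?\<phi> x = {g \<otimes> x \<otimes> inv g | g. g \<in> carrier G}" if "x \<in> carrier G" for x
    unfolding orbit_def using that by auto
  have conj_eq: "g \<otimes> x \<otimes> inv g = x \<longleftrightarrow> g \<otimes> x = x \<otimes> g" if "g \<in> carrier G" "x \<in> carrier G" for g x
    using that inv_solve_right'[of x "g \<otimes> x" g] by auto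
  define M where "M = N - group_center G"
  have finN: "finite N" using fin N.subset finite_subset by blast
  have orbM: "orbit G ?\<phi> x \<subseteq> M" if x: "x \<in> M" for x
  proof
    fix y assume "y \<in> orbit G ?\<phi> x"
    have xc: "x \<in> carrier G" "x \<in> N" "x \<notin> group_center G" using x N.subset by (auto simp: M_def)
    obtain g where g: "g \<in> carrier G" and y: "y = g \<otimes> x \<otimes> inv g"
      using \<open>y \<in> orbit G ?\<phi> x\<close> unfolding orbit_eq[OF xc(1)] by blast
    have "y \<in> N" unfolding y using N.inv_op_closed2[OF g xc(2)] .
    moreover have "y \<notin> group_center G"
    proof
      assume "y \<in> group_center G"
      then have "inv g \<otimes> y \<otimes> inv (inv g) \<in> group_center G"
        using normal.inv_op_closed2[OF group_center_normal, of "inv g" y] g by simp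
      moreover have "inv g \<otimes> (g \<otimes> x) = x" using xc g by (simp flip: m_assoc)
      ultimately show False using xc g by (simp add: y m_assoc)
    qed
    ultimately show "y \<in> M" by (simp add: M_def)
  qed
  have pM: "p dvd card (orbit G ?\<phi> x)" if x: "x \<in> M" for x
  proof -
    have xc: "x \<in> carrier G" "x \<notin> group_center G" using x N.subset by (auto simp: M_def)
    have "card (orbit G ?\<phi> x) dvd p ^ n"
      unfolding ord[symmetric] act.orbit_stabilizer_theorem[OF xc(1), symmetric] by (rule dvd_triv_left)
    then obtain i where i: "card (orbit G ?\<phi> x) = p ^ i"
      unfolding divides_primepow_nat[OF p] by blast
    have "i \<noteq> 0"
    proof
      assume "i = 0"
      with i have "card (orbit G ?\<phi> x) = 1" by simp
      then obtain y where y: "orbit G ?\<phi> x = {y}" by (rule card_1_singletonE)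
      have "g \<otimes> x \<otimes> inv g \<in> orbit G ?\<phi> x" if "g \<in> carrier G" for g
        unfolding orbit_eq[OF xc(1)] using that by blast
      then have all: "g \<otimes> x \<otimes> inv g = y" if "g \<in> carrier G" for g
        using that unfolding y by simp
      then have "y = x" using all[of \<one>] xc by simp
      then have "x \<in> group_center G"
        unfolding group_center_def using all conj_eq xc by auto
      with xc show False by simp
    qed
    then show ?thesis unfolding i by (simp add: dvd_power)
  qed
  define \<O> where "\<O> = orbit G ?\<phi> ` M"
  have M_Un: "\<Union>\<O> = M"
  proof -
    have "x \<in> orbit G ?\<phi> x" if "x \<in> M" for x
      using act.orbit_refl[of x] that N.subset by (auto simp: M_def)
    then show ?thesis unfolding \<O>_def using orbM by blast
  qed
  have "p dvd card (\<Union>\<O>)"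
  proof (rule dvd_partition)
    show "finite (\<Union>\<O>)" unfolding M_Un using finN by (simp add: M_def)
    show "\<forall>c\<in>\<O>. p dvd card c" unfolding \<O>_def using pM by blast
    show "\<forall>c1\<in>\<O>. \<forall>c2\<in>\<O>. c1 \<noteq> c2 \<longrightarrow> c1 \<inter> c2 = {}"
    proof (intro ballI impI)
      fix c1 c2 assume c: "c1 \<in> \<O>" "c2 \<in> \<O>" "c1 \<noteq> c2"
      then have "c1 \<in> orbits G (carrier G) ?\<phi>" "c2 \<in> orbits G (carrier G) ?\<phi>"
        using N.subset unfolding orbits_def \<O>_def M_def by blast+
      then show "c1 \<inter> c2 = {}" using c(3) act.disjoint_union by blast
    qed
  qed
  then have pM: "p dvd card M" unfolding M_Un .
  have "p dvd card N"
  proof -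
    have "card N dvd p ^ n" unfolding ord[symmetric] lagrange[OF N.subgroup_axioms, symmetric] by (rule dvd_triv_right)
    then obtain i where i: "card N = p ^ i" unfolding divides_primepow_nat[OF p] by blast
    have "i \<noteq> 0"
    proof
      assume "i = 0"
      with i have "card N = 1" by simp
      then obtain y where "N = {y}" by (rule card_1_singletonE)
      then show False using nt N.one_closed by blast
    qed
    then show ?thesis unfolding i by (simp add: dvd_power)
  qed
  moreover have "card N = card (N \<inter> group_center G) + card M"
    unfolding M_def using card_Int_Diff[OF finN] .
  ultimately have "p dvd card (N \<inter> group_center G)" using pM dvd_add_left_iff by metis
  moreover have one: "\<one> \<in> N \<inter> group_center G" using N.one_closed by (auto simp: group_center_def)
  ultimately have "card (N \<inter> group_center G) \<ge> p"
    using finN by (intro dvd_imp_le) (simp_all only: card_gt_0_iff finite_Int, blast)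
  then have "\<not> N \<inter> group_center G \<subseteq> {\<one>}"
    using p0 card_mono[of "{\<one>}" "N \<inter> group_center G"] by auto
  then obtain y where y: "y \<in> N" "y \<in> group_center G" "y \<noteq> \<one>" by blast
  have yc: "y \<in> carrier G" using y N.subset by blast
  have "ord y dvd p ^ n" using ord_dvd_group_order[OF yc] ord by simp
  then obtain i where i: "ord y = p ^ i" unfolding divides_primepow_nat[OF p] by blast
  have "i \<noteq> 0" using i y ord_eq_1[OF yc] by auto
  then obtain j where j: "i = Suc j" using not0_implies_Suc by blast
  \<comment> \<open>The order of \<open>y\<close> is p^(j+1), so this power has order
    \<open>p\<close>.\<close>
  define z where "z = y [^] (p ^ j)"
  have pw: "y [^] (k::nat) \<in> K" if "subgroup K G" "y \<in> K" for k K
    by (induction k) (use that in \<open>auto intro: subgroup.one_closed subgroup.m_closed\<close>)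
  have "ord z = p"
    unfolding z_def using ord_pow[OF yc, of "p ^ j"] i j p0 by simp
  moreover have "z \<in> N" unfolding z_def by (rule pw[OF N.subgroup_axioms y(1)])
  moreover have "z \<in> group_center G"
    unfolding z_def by (rule pw[OF normal_imp_subgroup[OF group_center_normal] y(2)])
  ultimately show thesis using that by blast
qed

text \<open>Cosets differ in type from elements, while an induction hypothesis speaks about groups
  over one fixed type. The quotient is therefore moved to chosen representatives inside
  \<open>G\<close>.\<close>

lemma quotient_on_same_type:
  assumes N: "N \<lhd> G"
  obtains H :: "('a, 'b) monoid_scheme" and \<pi> where "group H" "\<pi> \<in> hom G H"
    "\<pi> ` carrier G = carrier H" "Coset.kernel G H \<pi> = N"
proof -
  interpret N: normal N G by fact
  define \<sigma> where "\<sigma> B = (SOME x. x \<in> B)" for B :: "'a set"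
  define H where "H = G\<lparr>carrier := \<sigma> ` carrier (G Mod N),
    monoid.mult := (\<lambda>a b. \<sigma> ((N #> a) \<otimes>\<^bsub>G Mod N\<^esub> (N #> b))), one := \<sigma> \<one>\<^bsub>G Mod N\<^esub>\<rparr>"
  have \<sigma>: "N #> \<sigma> B = B" if B: "B \<in> carrier (G Mod N)" for B
  proof -
    obtain x where x: "x \<in> carrier G" "B = N #> x" using B unfolding carrier_FactGroup by blast
    have "\<sigma> B \<in> B" unfolding \<sigma>_def using rcos_self[OF x(1) N.subgroup_axioms] x(2) by (metis someI)
    then show ?thesis using repr_independence[OF _ x(1) N.subgroup_axioms] x(2) by simp
  qed
  have inj: "inj_on \<sigma> (carrier (G Mod N))" by (rule inj_on_inverseI[of _ "\<lambda>a. N #> a"]) (rule \<sigma>)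
  interpret F: group "G Mod N" by (rule N.factorgroup_is_group)
  have \<sigma>_hom: "\<sigma> \<in> hom (G Mod N) H"
    by (rule homI) (auto simp: H_def \<sigma>)
  have "\<sigma> \<in> iso (G Mod N) H"
    unfolding iso_def bij_betw_def using \<sigma>_hom inj by (simp add: H_def)
  from F.iso_imp_img_group[OF this] have H: "group H" by (simp add: H_def)
  have \<pi>: "(\<lambda>x. \<sigma> (N #> x)) \<in> hom G H"
    using Group.hom_compose[OF N.r_coset_hom_Mod \<sigma>_hom] by (simp add: comp_def)
  have "Coset.kernel G H (\<lambda>x. \<sigma> (N #> x)) = N"
  proof -
    have "\<sigma> (N #> x) = \<one>\<^bsub>H\<^esub> \<longleftrightarrow> x \<in> N" if x: "x \<in> carrier G" for x
    proof -
      have "\<sigma> (N #> x) = \<one>\<^bsub>H\<^esub> \<longleftrightarrow> N #> x = \<one>\<^bsub>G Mod N\<^esub>"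
        using inj_onD[OF inj] x F.one_closed by (auto simp: H_def carrier_FactGroup)
      also have "\<dots> \<longleftrightarrow> x \<in> N"
        using coset_join1[OF _ x N.subgroup_axioms] coset_join2[OF x N.subgroup_axioms] by (auto simp: FactGroup_def)
      finally show ?thesis .
    qed
    then show ?thesis using N.subset by (auto simp: kernel_def)
  qed
  moreover have "(\<lambda>x. \<sigma> (N #> x)) ` carrier G = carrier H"
    by (simp add: H_def carrier_FactGroup image_image)
  ultimately show thesis using that[OF H \<pi>] by blast
qed

end

section \<open>Induction on the order of the derived subgroup\<close>

lemma (in group) derived_trivial_if_center_whole:
  assumes "group_center G = carrier G"
  shows "derived G (carrier G) = {\<one>}"
proof -
  have "comm_group G"
    by (rule group_comm_groupI) (use assms in \<open>auto simp: group_center_def\<close>)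
  then show ?thesis using comm_group.derived_eq_singleton by blast
qed

lemma (in group) derived_trivial_imp_center:
  assumes "derived G (carrier G) = {\<one>}"
  shows "group_center G = carrier G"
proof -
  have "x \<otimes> y = y \<otimes> x" if xy: "x \<in> carrier G" "y \<in> carrier G" for x y
  proof -
    have "x \<otimes> y \<otimes> inv x \<otimes> inv y \<in> derived G (carrier G)"
      unfolding derived_def using xy by (intro generate.incl) auto
    then have "x \<otimes> y \<otimes> inv x \<otimes> inv y = \<one>" using assms by simp
    moreover have "x \<otimes> y \<otimes> inv x \<otimes> inv y \<otimes> (y \<otimes> x) = x \<otimes> y"
      using xy by (simp add: m_assoc inv_solve_left')
    ultimately show ?thesis using xy by simp
  qed
  then show ?thesis by (auto simp: group_center_def)
qed

text \<open>An isomorphism onto \<open>A\<close> is treated as the quotient by z = 1. The only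
  attached character is the trivial one, so the step costs nothing.\<close>

lemma schur_multiplier_bound_abelian:
  assumes "group G" "finite (carrier G)" "group A" "finite (carrier (schur_multiplier A))"
    and \<phi>: "\<phi> \<in> hom G A" "\<phi> ` carrier G = carrier A" "Coset.kernel G A \<phi> = {\<one>\<^bsub>G\<^esub>}"
  shows "finite (carrier (schur_multiplier G)) \<and>
    order (schur_multiplier G) \<le> order (schur_multiplier A)"
proof -
  interpret G: group G by fact
  interpret central_cyclic_quotient G A \<phi> "\<one>\<^bsub>G\<^esub>"
  proof (rule central_cyclic_quotientI)
    show "\<one>\<^bsub>G\<^esub> \<in> group_center G" by (simp add: group_center_def)
    show "Coset.kernel G A \<phi> = generate G {\<one>\<^bsub>G\<^esub>}" using \<phi> G.generate_one by simp
  qed (fact assms)+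
  let ?Q = "(\<lambda>f. restrict (cpair f \<one>\<^bsub>G\<^esub>) (carrier G)) ` cocycles G"
  have gen: "generate G ({} \<union> carrier G) = carrier G"
    using G.generate_incl[of "carrier G"] by (auto intro: generate.incl)
  have trivial: "cpair f \<one>\<^bsub>G\<^esub> s = 1" if "f \<in> cocycles G" "s \<in> carrier G" for f s
    using G.cpair_one[OF that] .
  have Q: "finite ?Q" "card ?Q \<le> G.ord \<one>\<^bsub>G\<^esub> ^ card ({} :: 'a set)"
    by (rule card_characters_le[OF finite.emptyI empty_subsetI subset_refl gen], fact trivial)+
  note bound = schur_multiplier_quotient_bound[OF Q(1) assms(4)]
  have "order (schur_multiplier G) \<le> card ?Q * order (schur_multiplier A)" by (rule bound(2))
  also have "\<dots> \<le> 1 * order (schur_multiplier A)" using Q(2) by (intro mult_le_mono1) simp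
  finally show ?thesis using bound(1) by simp
qed

text \<open>\<open>A\<close> is the abelianization, shared by \<open>G\<close> and all the quotients
  that occur. The commutator bound at derived order \<open>p\<close> costs one factor
  \<open>p\<close>; each of the \<open>k\<close> steps leading there costs p^e, where e + 1 takes
  the place of \<delta>.\<close>

lemma schur_multiplier_bound_derived:
  fixes G :: "('a, 'b) monoid_scheme" and A :: "('c, 'd) monoid_scheme" and p n k e :: nat
  assumes p: "Factorial_Ring.prime p" and A: "group A" "finite (carrier (schur_multiplier A))"
    and "group G" "order G = p ^ n" "card (derived G (carrier G)) = p ^ Suc k"
    and "\<phi> \<in> hom G A" "\<phi> ` carrier G = carrier A" "Coset.kernel G A \<phi> = derived G (carrier G)"
    and "finite T" "T \<subseteq> carrier G" "card T \<le> Suc e" "generate G (T \<union> group_center G) = carrier G"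
  shows "finite (carrier (schur_multiplier G)) \<and>
    order (schur_multiplier G) \<le> p ^ (1 + e * k) * order (schur_multiplier A)"
  using assms(4-)
proof (induction k arbitrary: G n \<phi> T)
  case (0 G n \<phi> T)
  interpret G: group G by fact
  have p1: "p > 1" using p by (rule prime_gt_1_nat)
  have fin: "finite (carrier G)" using 0(2) p1 by (simp add: G.order_gt_0_iff_finite[symmetric])
  define D where "D = derived G (carrier G)"
  have cD: "card D = p" using 0(3) by (simp add: D_def)
  have finD: "finite D" using cD p1 card.infinite by fastforce
  have subD: "subgroup D G" unfolding D_def by (rule G.derived_is_subgroup) simp
  have D1: "D \<noteq> {\<one>\<^bsub>G\<^esub>}" using cD p1 by auto
  have gen_eq: "generate G {z} = D" if z: "z \<in> D" "G.ord z = p" for z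
  proof (rule card_subset_eq[OF finD])
    show "generate G {z} \<subseteq> D" by (rule G.generate_subgroup_incl) (use z subD in auto)
    have "z \<in> carrier G" using z subgroup.subset[OF subD] by blast
    then show "card (generate G {z}) = card D" using G.generate_pow_card z cD by simp
  qed
  obtain z0 where z0: "z0 \<in> D" "z0 \<in> group_center G" "G.ord z0 = p"
    using G.central_element_of_prime_order[OF p 0(2), of D] G.derived_self_is_normal D1
    unfolding D_def by blast
  \<comment> \<open>A nontrivial normal subgroup contains a central element of order
    \<open>p\<close>, and here such an element generates \<open>D\<close>.\<close>
  have D_center: "D \<subseteq> group_center G"
    unfolding gen_eq[OF z0(1,3), symmetric]
    by (rule G.generate_subgroup_incl) (use z0 normal_imp_subgroup[OF G.group_center_normal] in auto)
  \<comment> \<open>The sharper bound calls for a generator of \<open>D\<close> that is itself a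
    commutator.\<close>
  have "\<not> derived_set G (carrier G) \<subseteq> {\<one>\<^bsub>G\<^esub>}"
  proof
    assume "derived_set G (carrier G) \<subseteq> {\<one>\<^bsub>G\<^esub>}"
    then have "D \<subseteq> generate G {\<one>\<^bsub>G\<^esub>}" unfolding D_def derived_def by (rule G.mono_generate)
    then show False using D1 G.generate_one subgroup.one_closed[OF subD] by auto
  qed
  then obtain x y where xy: "x \<in> carrier G" "y \<in> carrier G"
    and nt: "x \<otimes>\<^bsub>G\<^esub> y \<otimes>\<^bsub>G\<^esub> inv\<^bsub>G\<^esub> x \<otimes>\<^bsub>G\<^esub> inv\<^bsub>G\<^esub> y \<noteq> \<one>\<^bsub>G\<^esub>" by blast
  define z where "z = x \<otimes>\<^bsub>G\<^esub> y \<otimes>\<^bsub>G\<^esub> inv\<^bsub>G\<^esub> x \<otimes>\<^bsub>G\<^esub> inv\<^bsub>G\<^esub> y"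
  have zc: "z \<in> carrier G" using xy by (simp add: z_def)
  have zD: "z \<in> D" unfolding D_def derived_def z_def using xy by (intro generate.incl) auto
  have "G.ord z dvd p ^ n" using G.ord_dvd_group_order[OF zc] 0(2) by simp
  then obtain i where i: "G.ord z = p ^ i" unfolding divides_primepow_nat[OF p] by blast
  have "i \<noteq> 0" using i nt G.ord_eq_1[OF zc] by (auto simp: z_def)
  have "generate G {z} \<subseteq> D" by (rule G.generate_subgroup_incl) (use zD subD in auto)
  then have "p ^ i \<le> p ^ 1" using card_mono[OF finD] G.generate_pow_card[OF zc] i cD by simp
  then have "i \<le> 1" using p1 power_increasing_iff[of p i 1] by simp
  with \<open>i \<noteq> 0\<close> i have ord: "G.ord z = p" by (cases i) auto
  interpret central_cyclic_quotient G A \<phi> z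
  proof (rule central_cyclic_quotientI)
    show "z \<in> group_center G" using zD D_center by blast
    show "Coset.kernel G A \<phi> = generate G {z}" using gen_eq[OF zD ord] 0(6) by (simp add: D_def)
  qed (fact 0 fin A)+
  have der: "derived G (carrier G) = generate G {z}" using gen_eq[OF zD ord] by (simp add: D_def)
  show ?case
    using schur_multiplier_bound_commutator[OF A(2) p ord xy z_def der] by simp
next
  case (Suc k G n \<phi> T)
  interpret G: group G by fact
  have p1: "p > 1" using p by (rule prime_gt_1_nat)
  have fin: "finite (carrier G)" using Suc.prems(2) p1 by (simp add: G.order_gt_0_iff_finite[symmetric])
  define D where "D = derived G (carrier G)"
  have subD: "subgroup D G" unfolding D_def by (rule G.derived_is_subgroup) simp
  have "card D \<noteq> 1" using Suc.prems(3) p1 by (auto simp: D_def)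
  then have "D \<noteq> {\<one>\<^bsub>G\<^esub>}" by auto
  then obtain z where z: "z \<in> D" "z \<in> group_center G" "G.ord z = p"
    using G.central_element_of_prime_order[OF p Suc.prems(2), of D] G.derived_self_is_normal
    unfolding D_def by blast
  have zc: "z \<in> carrier G" using G.group_centerD(1)[OF z(2)] .
  define N where "N = generate G {z}"
  have "N \<lhd> G"
    unfolding N_def
  proof (rule G.normal_generateI)
    fix h g assume "h \<in> {z}" and g: "g \<in> carrier G"
    then have "g \<otimes>\<^bsub>G\<^esub> h \<otimes>\<^bsub>G\<^esub> inv\<^bsub>G\<^esub> g = h"
      using G.group_centerD(2)[OF z(2) g, symmetric] zc by (simp add: G.m_assoc)
    with \<open>h \<in> {z}\<close> show "g \<otimes>\<^bsub>G\<^esub> h \<otimes>\<^bsub>G\<^esub> inv\<^bsub>G\<^esub> g \<in> {z}" by simp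
  qed (use zc in simp)
  then obtain H :: "('a, 'b) monoid_scheme" and \<pi> where H: "group H" and \<pi>: "\<pi> \<in> hom G H"
    "\<pi> ` carrier G = carrier H" "Coset.kernel G H \<pi> = N"
    by (rule G.quotient_on_same_type)
  have "N \<subseteq> D" unfolding N_def by (rule G.generate_subgroup_incl) (use z subD in auto)
  have cN: "card N = p" unfolding N_def using G.generate_pow_card[OF zc] z(3) by simp
  interpret central_cyclic_quotient G H \<pi> z
  proof (rule central_cyclic_quotientI)
    show "Coset.kernel G H \<pi> = generate G {z}" using \<pi>(3) by (simp add: N_def)
  qed (fact \<pi> z fin H G.is_group)+
  interpret \<phi>: group_hom G A \<phi>
    using G.is_group A(1) Suc.prems(4) by (simp add: group_hom_def group_hom_axioms_def)
  have factor: "\<phi> x = \<phi> y" if xy: "x \<in> carrier G" "y \<in> carrier G" "\<pi> x = \<pi> y" for x y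
  proof -
    have "z \<in> Coset.kernel G A \<phi>" using z(1) Suc.prems(6) by (simp add: D_def)
    then have \<phi>z: "\<phi> z = \<one>\<^bsub>A\<^esub>" by (simp add: kernel_def)
    have "\<phi> (z \<otimes>\<^bsub>G\<^esub> u) = \<phi> u" if u: "u \<in> carrier G" for u
      unfolding \<phi>.hom_mult[OF zc u] \<phi>z using \<phi>.hom_closed[OF u] by (rule \<phi>.H.l_one)
    then show ?thesis using fibrewise_constant[of \<phi>] xy by blast
  qed
  \<comment> \<open>The map induced by \<phi> on \<open>H\<close>. It is again the abelianization
    map: its kernel turns out to be the derived subgroup of \<open>H\<close>.\<close>
  define \<psi> where "\<psi> a = \<phi> (lift a)" for a
  have \<psi>: "\<psi> (\<pi> x) = \<phi> x" if "x \<in> carrier G" for x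
    unfolding \<psi>_def by (rule factor) (use that lift_closed image_lift in auto)
  have H_image: "\<exists>x\<in>carrier G. a = \<pi> x" if "a \<in> carrier H" for a
    using that \<pi>(2) by blast
  have derH: "derived H (carrier H) = \<pi> ` D"
    unfolding D_def using derived_img[of "carrier G"] \<pi>(2) by simp
  have 1: "order H = p ^ (n - 1) \<and> n \<ge> 1"
  proof -
    have eq: "order H * p = p ^ n"
      using card_image_mult_card_kernel \<pi>(2,3) cN Suc.prems(2) by (simp add: order_def)
    have "n \<noteq> 0" using eq p1 by (intro notI) auto
    then obtain n' where "n = Suc n'" using not0_implies_Suc by blast
    then show ?thesis using eq p1 by simp
  qed
  have 2: "card (derived H (carrier H)) = p ^ Suc k"
  proof -
    interpret DG: group "G\<lparr>carrier := D\<rparr>" by (rule G.subgroup_imp_group[OF subD])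
    interpret D: group_hom "G\<lparr>carrier := D\<rparr>" H \<pi>
    proof unfold_locales
      show "\<pi> \<in> hom (G\<lparr>carrier := D\<rparr>) H"
        using \<pi>(1) subgroup.subset[OF subD] unfolding hom_def by (simp add: Pi_iff subset_iff)
    qed
    have "Coset.kernel (G\<lparr>carrier := D\<rparr>) H \<pi> = N"
      unfolding \<pi>(3)[symmetric]
      using \<open>N \<subseteq> D\<close> subgroup.subset[OF subD] unfolding \<pi>(3)[symmetric] by (auto simp: kernel_def)
    then have "card (\<pi> ` D) * p = card D"
      using D.card_image_mult_card_kernel cN by (simp add: order_def)
    then show ?thesis using derH Suc.prems(3) p1 by (simp add: D_def)
  qed
  have 3: "\<psi> \<in> hom H A"
  proof (rule homI)
    fix a b assume "a \<in> carrier H" "b \<in> carrier H"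
    then obtain x y where xy: "x \<in> carrier G" "y \<in> carrier G" and a: "a = \<pi> x" "b = \<pi> y"
      using H_image by blast
    show "\<psi> (a \<otimes>\<^bsub>H\<^esub> b) = \<psi> a \<otimes>\<^bsub>A\<^esub> \<psi> b"
      unfolding a using \<psi>[of "x \<otimes>\<^bsub>G\<^esub> y"] xy by (simp add: \<psi>)
  qed (simp add: \<psi>_def lift_closed)
  have 4: "\<psi> ` carrier H = carrier A"
    unfolding \<pi>(2)[symmetric] Suc.prems(5)[symmetric] by (simp add: image_image \<psi> cong: image_cong)
  have 5: "Coset.kernel H A \<psi> = derived H (carrier H)"
  proof -
    have "Coset.kernel H A \<psi> = \<pi> ` Coset.kernel G A \<phi>"
    proof (intro equalityI subsetI)
      fix a assume "a \<in> Coset.kernel H A \<psi>"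
      then have "a \<in> carrier H" and 1: "\<psi> a = \<one>\<^bsub>A\<^esub>" by (simp_all add: kernel_def)
      then obtain x where x: "x \<in> carrier G" and a: "a = \<pi> x" using H_image by blast
      have "\<phi> x = \<one>\<^bsub>A\<^esub>" using 1 \<psi>[OF x] a by simp
      then show "a \<in> \<pi> ` Coset.kernel G A \<phi>" using x a by (simp add: kernel_def)
    next
      fix a assume "a \<in> \<pi> ` Coset.kernel G A \<phi>"
      then obtain x where x: "x \<in> carrier G" "\<phi> x = \<one>\<^bsub>A\<^esub>" and a: "a = \<pi> x" by (auto simp: kernel_def)
      then show "a \<in> Coset.kernel H A \<psi>" using \<psi>[OF x(1)] by (simp add: kernel_def)
    qed
    then show ?thesis unfolding derH D_def Suc.prems(6) .
  qed
  have "generate H (\<pi> ` (T \<union> group_center G)) = carrier H"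
    using generate_img[of "T \<union> group_center G"] Suc.prems(8,10) \<pi>(2) by (auto simp: group_center_def)
  moreover have "\<pi> ` (T \<union> group_center G) \<subseteq> \<pi> ` T \<union> group_center H"
  proof -
    have "\<pi> s \<in> group_center H" if "s \<in> group_center G" for s
    proof -
      have "\<pi> s \<otimes>\<^bsub>H\<^esub> a = a \<otimes>\<^bsub>H\<^esub> \<pi> s" if a: "a \<in> carrier H" for a
      proof -
        obtain x where x: "x \<in> carrier G" and ax: "a = \<pi> x" using H_image[OF a] by blast
        have "\<pi> (s \<otimes>\<^bsub>G\<^esub> x) = \<pi> (x \<otimes>\<^bsub>G\<^esub> s)" using G.group_centerD(2)[OF \<open>s \<in> group_center G\<close> x] by simp
        then show ?thesis using x G.group_centerD(1)[OF \<open>s \<in> group_center G\<close>] by (simp add: ax)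
      qed
      then show ?thesis
        using G.group_centerD(1)[OF \<open>s \<in> group_center G\<close>] by (auto simp: group_center_def)
    qed
    then show ?thesis by blast
  qed
  moreover have T: "\<pi> ` T \<union> group_center H \<subseteq> carrier H"
    using Suc.prems(8) by (auto simp: group_center_def)
  ultimately have 9: "generate H (\<pi> ` T \<union> group_center H) = carrier H"
    using H.mono_generate H.generate_incl[OF T] by blast
  have 6: "finite (\<pi> ` T)" and 7: "\<pi> ` T \<subseteq> carrier H" and 8: "card (\<pi> ` T) \<le> Suc e"
    using Suc.prems(7) T card_image_le[OF Suc.prems(7), of \<pi>] Suc.prems(9) by auto
  have IH: "finite (carrier (schur_multiplier H)) \<and>
      order (schur_multiplier H) \<le> p ^ (1 + e * k) * order (schur_multiplier A)"
    by (rule Suc.IH[OF H conjunct1[OF 1] 2 3 4 5 6 7 8 9])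
  have bound: "finite (carrier (schur_multiplier G))"
    "order (schur_multiplier G) \<le> p ^ e * order (schur_multiplier H)"
    using schur_multiplier_bound_modulo_center[OF conjunct1[OF IH] p z(3) z(1)[unfolded D_def] Suc.prems(7-10)] .
  note bound(2)
  also have "p ^ e * order (schur_multiplier H) \<le> p ^ e * (p ^ (1 + e * k) * order (schur_multiplier A))"
    using IH by (intro mult_le_mono2) simp
  also have "\<dots> = p ^ (1 + e * Suc k) * order (schur_multiplier A)"
    by (simp add: power_add algebra_simps)
  finally show ?case using bound(1) by simp
qed

section \<open>The bound for finite p-groups\<close>

lemma (in group) min_generators_attained:
  assumes "finite (carrier G)"
  obtains S where "S \<subseteq> carrier G" "finite S" "card S = min_generators G" "generate G S = carrier G"
proof -
  let ?P = "\<lambda>m. \<exists>S. S \<subseteq> carrier G \<and> finite S \<and> card S = m \<and> generate G S = carrier G"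
  have "generate G (carrier G) = carrier G"
    using generate_incl[of "carrier G"] by (auto intro: generate.incl)
  then have "?P (card (carrier G))" using assms by blast
  then have "?P (min_generators G)" unfolding min_generators_def by (rule LeastI)
  then show thesis using that by blast
qed

text \<open>Every generator of G/Z(G) is lifted to a single element, and the center absorbs the
  ambiguity of the lifts.\<close>

lemma (in group) generators_modulo_center:
  assumes "finite (carrier G)"
  obtains T where "finite T" "T \<subseteq> carrier G" "card T \<le> min_generators (G Mod group_center G)"
    "generate G (T \<union> group_center G) = carrier G"
proof -
  interpret Z: normal "group_center G" G by (rule group_center_normal)
  interpret F: group "G Mod group_center G" by (rule Z.factorgroup_is_group)
  let ?q = "\<lambda>x. group_center G #> x"
  interpret q: group_hom G "G Mod group_center G" ?q
    using Z.r_coset_hom_Mod by unfold_locales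
  have "finite (carrier (G Mod group_center G))"
    using assms by (simp add: carrier_FactGroup)
  then obtain S where S: "S \<subseteq> carrier (G Mod group_center G)" "finite S"
    "card S = min_generators (G Mod group_center G)"
    "generate (G Mod group_center G) S = carrier (G Mod group_center G)"
    by (rule F.min_generators_attained)
  have "S \<subseteq> ?q ` carrier G" using S(1) by (simp add: carrier_FactGroup)
  then obtain T where T: "T \<subseteq> carrier G" "inj_on ?q T" "S = ?q ` T"
    unfolding subset_image_inj by blast
  have finT: "finite T" using finite_imageD[OF _ T(2)] S(2) T(3) by simp
  have cardT: "card T = card S" using card_image[OF T(2)] T(3) by simp
  have TZ: "T \<union> group_center G \<subseteq> carrier G" using T(1) Z.subset by blast
  interpret K: subgroup "generate G (T \<union> group_center G)" G by (rule generate_is_subgroup[OF TZ])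
  have "x \<in> generate G (T \<union> group_center G)" if x: "x \<in> carrier G" for x
  proof -
    have "?q x \<in> ?q ` generate G T"
      using q.generate_img[OF T(1)] S(4) x unfolding T(3)[symmetric] carrier_FactGroup by blast
    then obtain t where t: "t \<in> generate G T" "?q x = ?q t" by blast
    have "x \<in> ?q t" using rcos_self[OF x Z.subgroup_axioms] t(2) by simp
    then obtain s where s: "s \<in> group_center G" "x = s \<otimes> t" by (auto simp: r_coset_def)
    have "t \<in> generate G (T \<union> group_center G)" using t(1) mono_generate[of T "T \<union> group_center G"] by blast
    moreover have "s \<in> generate G (T \<union> group_center G)" using s(1) by (intro generate.incl) simp
    ultimately show ?thesis unfolding s(2) by (rule K.m_closed[rotated])
  qed
  then have "generate G (T \<union> group_center G) = carrier G" using K.subset by blast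
  then show thesis using that[OF finT T(1)] cardT S(3) by simp
qed

text \<open>The classical fact that a cyclic G/Z(G) makes \<open>G\<close> abelian: a lone element
  of \<open>T\<close> commutes with itself and with the center, hence with everything. It excludes
  \<delta> < 2 when the derived subgroup is nontrivial.\<close>

lemma (in group) center_cyclic_quotient_imp_abelian:
  assumes T: "finite T" "T \<subseteq> carrier G" "card T \<le> 1"
    and gen: "generate G (T \<union> group_center G) = carrier G"
  shows "group_center G = carrier G"
proof -
  have "s \<in> group_center G" if s: "s \<in> T" for s
  proof -
    have sc: "s \<in> carrier G" using s T by blast
    have Ts: "t = s" if "t \<in> T" for t using T(1,3) s that card_le_Suc0_iff_eq[of T] by simp
    let ?C = "{x \<in> carrier G. s \<otimes> x = x \<otimes> s}"
    have "subgroup ?C G"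
    proof (rule subgroupI)
      fix a b assume "a \<in> ?C" "b \<in> ?C"
      then have ab: "a \<in> carrier G" "b \<in> carrier G" and sa: "s \<otimes> a = a \<otimes> s" and sb: "s \<otimes> b = b \<otimes> s"
        by blast+
      have "s \<otimes> (a \<otimes> b) = (s \<otimes> a) \<otimes> b" using ab sc by (simp add: m_assoc)
      also have "\<dots> = a \<otimes> (s \<otimes> b)" unfolding sa using ab sc by (simp add: m_assoc)
      also have "\<dots> = (a \<otimes> b) \<otimes> s" unfolding sb using ab sc by (simp add: m_assoc)
      finally show "a \<otimes> b \<in> ?C" using ab by simp
    next
      fix a assume "a \<in> ?C"
      then have a: "a \<in> carrier G" "s \<otimes> a = a \<otimes> s" by blast+
      have "inv a \<otimes> s = s \<otimes> inv a"
        by (metis a sc inv_closed inv_solve_left inv_solve_right m_assoc m_closed)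
      then show "inv a \<in> ?C" using a by simp
    qed (use sc in auto)
    then have "generate G (T \<union> group_center G) \<subseteq> ?C"
      by (intro generate_subgroup_incl) (use Ts sc group_centerD(1) group_centerD(2)[of _ s, symmetric] in auto)
    then show ?thesis using gen sc unfolding group_center_def by blast
  qed
  then have "generate G (T \<union> group_center G) \<subseteq> group_center G"
    by (intro generate_subgroup_incl normal_imp_subgroup group_center_normal) blast
  then show ?thesis using gen normal_imp_subgroup[OF group_center_normal] subgroup.subset by blast
qed

text \<open>The weights \<open>2 i - d - 1\<close> are antisymmetric under
  \<open>i \<mapsto> d + 1 - i\<close>.\<close>
lemma weighted_sum_antimono_le:
  fixes b :: "nat \<Rightarrow> real"
  assumes d: "d \<ge> 1" and mono: "\<And>i j. 1 \<le> i \<Longrightarrow> i \<le> j \<Longrightarrow> j \<le> d \<Longrightarrow> b j \<le> b i"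
  shows "(\<Sum>i\<in>{1..d}. (real i - 1) * b i) \<le> 1 / 2 * (real d - 1) * ((\<Sum>i\<in>{1..d}. b i) - (b 1 - b d))"
proof -
  define c where "c i = 2 * real i - real d - 1" for i :: nat
  define t where "t i = c i * (b i - b (d + 1 - i))" for i
  have "(\<Sum>i\<in>{1..d}. c i * b i) = (\<Sum>i\<in>{1..d}. c (d + 1 - i) * b (d + 1 - i))"
    using sum.atLeastAtMost_rev[of "\<lambda>i. c i * b i" 1 d] by (simp add: add.commute)
  also have "\<dots> = (\<Sum>i\<in>{1..d}. - (c i * b (d + 1 - i)))"
  proof (rule sum.cong)
    fix i assume "i \<in> {1..d}"
    then have "c (d + 1 - i) = - c i" by (simp add: c_def of_nat_diff)
    then show "c (d + 1 - i) * b (d + 1 - i) = - (c i * b (d + 1 - i))" by simp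
  qed simp
  finally have two: "2 * (\<Sum>i\<in>{1..d}. c i * b i) = (\<Sum>i\<in>{1..d}. t i)"
    by (simp add: t_def right_diff_distrib sum_subtractf sum_negf)
  have neg: "t i \<le> 0" if "i \<in> {1..d}" for i
  proof (cases "2 * i \<le> d + 1")
    case True
    then have "c i \<le> 0" unfolding c_def by linarith
    moreover have "b (d + 1 - i) \<le> b i" using that True by (intro mono) auto
    ultimately show ?thesis unfolding t_def by (simp add: mult_nonpos_nonneg)
  next
    case False
    then have "c i \<ge> 0" unfolding c_def by linarith
    moreover have "b i \<le> b (d + 1 - i)" using that False by (intro mono) auto
    ultimately show ?thesis unfolding t_def by (simp add: mult_nonneg_nonpos)
  qed
  \<comment> \<open>Only i = 1 and i = d are kept, and each contributes -(d - 1) (b 1 - b d). For d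
    = 1 the two indices coincide and the sum is 0.\<close>
  have "(\<Sum>i\<in>{1..d}. t i) \<le> (\<Sum>i\<in>{1, d}. t i)"
    using sum_mono2[of "{1..d}" "{1, d}" "\<lambda>i. - t i"] d neg by (auto simp: sum_negf)
  also have "\<dots> = - 2 * (real d - 1) * (b 1 - b d)"
    using d by (cases "d = 1") (auto simp: t_def c_def algebra_simps)
  finally have "(\<Sum>i\<in>{1..d}. c i * b i) \<le> - (real d - 1) * (b 1 - b d)"
    using two by (simp only: mult_minus_left mult.assoc)
  \<comment> \<open>Since c i = 2 (i - 1) - (d - 1), this leads back to the weights i - 1.\<close>
  moreover have "c i * b i = 2 * ((real i - 1) * b i) - (real d - 1) * b i" for i
    by (simp add: c_def algebra_simps)
  then have "(\<Sum>i\<in>{1..d}. c i * b i)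
      = 2 * (\<Sum>i\<in>{1..d}. (real i - 1) * b i) - (real d - 1) * (\<Sum>i\<in>{1..d}. b i)"
    by (simp only: sum_subtractf sum_distrib_left)
  moreover have "1 / 2 * (real d - 1) * ((\<Sum>i\<in>{1..d}. b i) - (b 1 - b d))
      = ((real d - 1) * (\<Sum>i\<in>{1..d}. b i) + - (real d - 1) * (b 1 - b d)) / 2"
    by (simp add: field_simps)
  moreover have "W \<le> V" if "S \<le> Y" "S = 2 * W - Z" "V = (Z + Y) / 2" for S W V Y Z :: real
    using that by (simp add: field_simps)
  ultimately show ?thesis by blast
qed

theorem theorem1p2:
  fixes G :: "('a, 'b) monoid_scheme" and p n k d \<delta> :: nat and \<alpha> :: "nat \<Rightarrow> nat"
  assumes "Factorial_Ring.prime p"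
    and "group G" and "finite (carrier G)" and "carrier G \<noteq> {\<one>\<^bsub>G\<^esub>}"
    and "order G = p ^ n"
    and "card (derived G (carrier G)) = p ^ k"
    and "min_generators G = d"
    and "min_generators (G Mod group_center G) = \<delta>"
    and "G Mod derived G (carrier G) \<cong> product_group {1..d} (\<lambda>i. integer_mod_group (p ^ \<alpha> i))"
    and "\<And>i j. 1 \<le> i \<Longrightarrow> i \<le> j \<Longrightarrow> j \<le> d \<Longrightarrow> \<alpha> j \<le> \<alpha> i"
    and "1 \<le> \<alpha> d"
  shows "finite (carrier (schur_multiplier G)) \<and>
    real (order (schur_multiplier G)) \<le>
      real p powr (1 / 2 * (real d - 1) * (real n - real k - (real (\<alpha> 1) - real (\<alpha> d)))
        + (real \<delta> - 1) * real k - max 0 (real \<delta> - 2))"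
proof -
  interpret G: group G by fact
  note p = \<open>Factorial_Ring.prime p\<close>
  have p1: "p > 1" using p by (rule prime_gt_1_nat)
  define m where "m i = p ^ \<alpha> i" for i
  have m: "m i > 0" for i using p1 by (simp add: m_def)
  define A where "A = cyclic_product m d"
  have A: "group A" unfolding A_def using comm_group_cyclic_product[where m = m and d = d, OF m] by (rule comm_group.axioms(2))
  \<comment> \<open>A natural exponent for the abelianization; the possibly fractional one of the
    claim enters only through \<open>a_le\<close>.\<close>
  define a where "a = (\<Sum>i\<in>{1..d}. (i - 1) * \<alpha> i)"
  have MA: "finite (carrier (schur_multiplier A))" "order (schur_multiplier A) \<le> p ^ a"
    using schur_multiplier_cyclic_product[where m = m and d = d, OF m]
    by (simp_all add: A_def a_def m_def[abs_def] power_sum power_mult[symmetric] mult.commute)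
  have orderA: "order A = p ^ (\<Sum>i\<in>{1..d}. \<alpha> i)"
    unfolding A_def order_cyclic_product[where m = m and d = d, OF m] by (simp add: m_def power_sum)
  let ?D = "derived G (carrier G)"
  interpret D: normal ?D G by (rule G.derived_self_is_normal)
  obtain \<psi> where \<psi>: "\<psi> \<in> iso (G Mod ?D) A"
    using assms(9) unfolding is_iso_def A_def cyclic_product_def m_def by blast
  define \<phi> where "\<phi> x = \<psi> (?D #>\<^bsub>G\<^esub> x)" for x
  have \<phi>: "\<phi> \<in> hom G A"
    using Group.hom_compose[OF D.r_coset_hom_Mod iso_imp_homomorphism[OF \<psi>]] by (simp add: comp_def \<phi>_def[abs_def])
  have \<phi>_surj: "\<phi> ` carrier G = carrier A"
  proof -
    have "\<phi> ` carrier G = \<psi> ` carrier (G Mod ?D)" by (simp add: \<phi>_def carrier_FactGroup image_image)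
    then show ?thesis using \<psi> by (simp add: iso_def bij_betw_def)
  qed
  have \<phi>_ker: "Coset.kernel G A \<phi> = ?D"
  proof -
    have F: "group (G Mod ?D)" by (rule D.factorgroup_is_group)
    have "\<phi> x = \<one>\<^bsub>A\<^esub> \<longleftrightarrow> x \<in> ?D" if x: "x \<in> carrier G" for x
    proof -
      have "inj_on \<psi> (carrier (G Mod ?D))" using \<psi> by (simp add: iso_def bij_betw_def)
      moreover have "\<psi> \<one>\<^bsub>G Mod ?D\<^esub> = \<one>\<^bsub>A\<^esub>"
        by (rule Group.hom_one[OF iso_imp_homomorphism[OF \<psi>] F A])
      moreover have "?D #>\<^bsub>G\<^esub> x \<in> carrier (G Mod ?D)" using x unfolding carrier_FactGroup by blast
      moreover have "\<one>\<^bsub>G Mod ?D\<^esub> \<in> carrier (G Mod ?D)" using group.is_monoid[OF F] by (rule monoid.one_closed)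
      ultimately have "\<phi> x = \<one>\<^bsub>A\<^esub> \<longleftrightarrow> ?D #>\<^bsub>G\<^esub> x = \<one>\<^bsub>G Mod ?D\<^esub>"
        unfolding \<phi>_def by (metis inj_onD)
      also have "\<dots> \<longleftrightarrow> x \<in> ?D"
        using G.coset_join1[OF _ x D.subgroup_axioms] G.coset_join2[OF x D.subgroup_axioms]
        by (auto simp: FactGroup_def)
      finally show ?thesis .
    qed
    then show ?thesis using D.subset by (auto simp: kernel_def)
  qed
  have n: "n = (\<Sum>i\<in>{1..d}. \<alpha> i) + k"
  proof -
    interpret \<phi>: group_hom G A \<phi>
      using G.is_group A \<phi> by (simp add: group_hom_def group_hom_axioms_def)
    have "p ^ ((\<Sum>i\<in>{1..d}. \<alpha> i) + k) = p ^ n"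
      using \<phi>.card_image_mult_card_kernel orderA assms(5,6) \<phi>_surj \<phi>_ker
      by (simp add: order_def power_add)
    then show ?thesis using p1 power_inject_exp[of p] by simp
  qed
  have d1: "d \<ge> 1"
  proof (rule ccontr)
    assume "\<not> d \<ge> 1"
    with assms(7) have 0: "min_generators G = 0" by simp
    obtain S where S: "S \<subseteq> carrier G" "finite S" "card S = min_generators G" "generate G S = carrier G"
      by (rule G.min_generators_attained[OF assms(3)])
    then have "S = {}" using 0 by simp
    then have "carrier G = {\<one>\<^bsub>G\<^esub>}" using S(4) G.generate_empty by simp
    with assms(4) show False by simp
  qed
  have a_le: "real a \<le> 1 / 2 * (real d - 1) * (real n - real k - (real (\<alpha> 1) - real (\<alpha> d)))"
  proof -
    have "real a = (\<Sum>i\<in>{1..d}. (real i - 1) * real (\<alpha> i))"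
      unfolding a_def of_nat_sum by (rule sum.cong) (auto simp: of_nat_diff)
    also have "\<dots> \<le> 1 / 2 * (real d - 1) * ((\<Sum>i\<in>{1..d}. real (\<alpha> i)) - (real (\<alpha> 1) - real (\<alpha> d)))"
      using assms(10) by (intro weighted_sum_antimono_le d1) simp
    also have "(\<Sum>i\<in>{1..d}. real (\<alpha> i)) = real n - real k" by (simp add: n)
    finally show ?thesis .
  qed
  let ?E = "(real \<delta> - 1) * real k - max 0 (real \<delta> - 2)"
  \<comment> \<open>Here \<open>b\<close> is the cost of dividing out the derived subgroup.\<close>
  have "\<exists>b. finite (carrier (schur_multiplier G)) \<and> order (schur_multiplier G) \<le> p ^ (b + a) \<and> real b \<le> ?E"
  proof (cases k)
    case 0
    then have "card ?D = 1" using assms(6) by simp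
    then obtain u where "?D = {u}" by (rule card_1_singletonE)
    then have D1: "?D = {\<one>\<^bsub>G\<^esub>}" using D.one_closed by simp
    then have Z: "group_center G = carrier G" by (rule G.derived_trivial_imp_center)
    interpret Z: normal "group_center G" G by (rule G.group_center_normal)
    \<comment> \<open>The trivial group G/Z(G) has rank 0, so that \<open>?E\<close> is 0 as
      well.\<close>
    have "\<delta> = 0"
    proof -
      have F: "group (G Mod group_center G)" by (rule Z.factorgroup_is_group)
      have "carrier (G Mod group_center G) = {\<one>\<^bsub>G Mod group_center G\<^esub>}"
      proof -
        have "group_center G #>\<^bsub>G\<^esub> x = group_center G" if "x \<in> carrier G" for x
          by (rule G.coset_join2[OF that Z.subgroup_axioms]) (simp add: Z that)
        moreover have "\<one>\<^bsub>G Mod group_center G\<^esub> = group_center G" by (simp add: FactGroup_def)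
        ultimately show ?thesis unfolding carrier_FactGroup using G.one_closed by force
      qed
      then have "generate (G Mod group_center G) {} = carrier (G Mod group_center G)"
        using group.generate_empty[OF F] by simp
      then have "\<exists>S. S \<subseteq> carrier (G Mod group_center G) \<and> finite S \<and> card S = 0
          \<and> generate (G Mod group_center G) S = carrier (G Mod group_center G)"
        by (intro exI[of _ "{}"]) simp
      then have "min_generators (G Mod group_center G) \<le> 0"
        unfolding min_generators_def by (rule Least_le)
      then show ?thesis using assms(8) by simp
    qed
    moreover have "finite (carrier (schur_multiplier G)) \<and> order (schur_multiplier G) \<le> order (schur_multiplier A)"
      using schur_multiplier_bound_abelian[OF G.is_group assms(3) A MA(1) \<phi> \<phi>_surj] \<phi>_ker D1 by simp
    ultimately show ?thesis using MA(2) 0 by (intro exI[of _ 0]) auto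
  next
    case (Suc k')
    obtain T where T: "finite T" "T \<subseteq> carrier G" "card T \<le> \<delta>" "generate G (T \<union> group_center G) = carrier G"
      using G.generators_modulo_center[OF assms(3)] unfolding assms(8) by blast
    have "\<delta> \<ge> 2"
    proof (rule ccontr)
      assume "\<not> \<delta> \<ge> 2"
      then have "group_center G = carrier G"
        using T by (intro G.center_cyclic_quotient_imp_abelian[of T]) auto
      then have "?D = {\<one>\<^bsub>G\<^esub>}" by (rule G.derived_trivial_if_center_whole)
      then have "p ^ k = 1" using assms(6) by simp
      then show False using p1 Suc by simp
    qed
    then obtain e where e: "\<delta> = Suc e" "e \<ge> 1" by (cases \<delta>) auto
    have *: "finite (carrier (schur_multiplier G)) \<and>
        order (schur_multiplier G) \<le> p ^ (1 + e * k') * order (schur_multiplier A)"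
      by (rule schur_multiplier_bound_derived[OF p A MA(1) G.is_group assms(5) assms(6)[unfolded Suc]
            \<phi> \<phi>_surj \<phi>_ker T(1,2) T(3)[unfolded e(1)] T(4)])
    have "p ^ (1 + e * k') * order (schur_multiplier A) \<le> p ^ (1 + e * k' + a)"
      unfolding power_add[of p "1 + e * k'" a] using MA(2) by (rule mult_le_mono2)
    then have "order (schur_multiplier G) \<le> p ^ (1 + e * k' + a)"
      by (rule le_trans[OF conjunct2[OF *]])
    \<comment> \<open>Equality holds: with \<delta> = e + 1 and k = k' + 1 the right side is e (k' +
      1) - (e - 1), where e >= 1 decides the maximum.\<close>
    moreover have "real (1 + e * k') \<le> ?E"
      using e by (simp add: Suc algebra_simps max_def)
    ultimately show ?thesis using conjunct1[OF *] by blast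
  qed
  then obtain b where fin: "finite (carrier (schur_multiplier G))"
    and b: "order (schur_multiplier G) \<le> p ^ (b + a)" "real b \<le> ?E" by blast
  have "real (order (schur_multiplier G)) \<le> real (p ^ (b + a))" using b(1) by (simp only: of_nat_le_iff)
  also have "\<dots> = real p powr real (b + a)" using p1 by (simp add: powr_realpow del: of_nat_add)
  also have "\<dots> \<le> real p powr (1 / 2 * (real d - 1) * (real n - real k - (real (\<alpha> 1) - real (\<alpha> d)))
        + (real \<delta> - 1) * real k - max 0 (real \<delta> - 2))"
    using p1 a_le b(2) by (intro powr_mono) auto
  finally show ?thesis using fin by blast
qed

end
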